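(* Let $(b_n)_{n\ge 1}$ be positive reals with $\lim_{n\to\infty}b_n=1$, let $b_0>0$, and let $b_0^c\in(0,\infty]$ be the critical value defined in the context. Consider both the free boundary condition and the zero boundary condition (bridge). (i) If $b_0<b_0^c$, there is a unique $\rho(b_0)$ (which is larger than one) such that $$\frac{\mathfrak{w}_1(\rho(b_0))}{4\rho(b_0)b_1}=b_0,$$ one has $\rho(b_0)=\rho_*(Q_{b_0})$, and the Gibbs potential coincides with $-\log\rho(b_0)$. (ii) If $b_0^c<\infty$ and $b_0>b_0^c$, then the Gibbs potential is equal to zero.
   Context: SOS model: configurations are $(X_0,\dots,X_N)$ with $X_0=0$, $X_i\in\mathbb{Z}_+=\{0,1,\dots\}$, $|X_{i+1}-X_i|=1$. Partition functions: $Z_N=\sum_{X_1,\dots,X_N}2^{-N}\prod_{n=0}^{N}b_{X_n}^{-1}$ (free boundary condition), and for the bridge $Z_{2N}$ is the same sum with length $2N$ restricted to $X_{2N}=0$. The Gibbs potential is $\Phi=\lim_{N\to\infty}-\frac1N\log Z_N$ (for the bridge, the limit of $-\frac{1}{2N}\log Z_{2N}$). Matrices: $Q_{b_0}=(Q_{p,q})_{p,q\ge0}$ with $Q_{p,q}=\frac{1}{2\sqrt{b_pb_q}}$ if $|p-q|=1$ and $0$ otherwise; $R$ is $Q_{b_0}$ without its first row and column (indices $\{1,2,\dots\}$; independent of $b_0$). For $M=Q_{b_0}$ or $R$, $\rho_*(M)=\lim_{n\to\infty}(M^{2n}_{i,j})^{1/(2n)}$ ($i-j$ even; the limit exists and does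 not depend on $i,j$). Put $\mathfrak{w}_1(\rho)=\inf\{w_1: w_p>0\ \forall p\ge 1,\ Rw=\rho w-\mathbf{1}_{p=1}\}$, with $\inf\emptyset=\infty$, and $b_0^c=\lim_{\rho\searrow\rho_*(R)}\frac{\mathfrak{w}_1(\rho)}{4b_1\rho}\in(0,\infty]$. *)

theory Defs
  imports "HOL-Analysis.Analysis"
begin

text \<open>
  A configuration \<open>(X\<^sub>0, \<dots>, X\<^sub>N)\<close> is a function on \<open>{0..N}\<close>, made extensional so that there are
  only finitely many of them.
\<close>

definition sos_paths :: "nat \<Rightarrow> (nat \<Rightarrow> nat) set" where
  "sos_paths N = {X \<in> {0..N} \<rightarrow>\<^sub>E UNIV. X 0 = 0 \<and>
     (\<forall>i<N. \<bar>int (X (Suc i)) - int (X i)\<bar> = 1)}"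

lemma finite_sos_paths: "finite (sos_paths N)"
proof (rule finite_subset)
  show "sos_paths N \<subseteq> {0..N} \<rightarrow>\<^sub>E {0..N}"
  proof
    fix X assume X: "X \<in> sos_paths N"
    have "i \<le> N \<Longrightarrow> X i \<le> i" for i
    proof (induction i)
      case 0
      then show ?case using X by (simp add: sos_paths_def)
    next
      case (Suc i)
      moreover have "\<bar>int (X (Suc i)) - int (X i)\<bar> = 1"
        using X Suc.prems by (simp add: sos_paths_def)
      ultimately show ?case by linarith
    qed
    then have "X i \<le> N" if "i \<le> N" for i
      using that le_trans by blast
    then show "X \<in> {0..N} \<rightarrow>\<^sub>E {0..N}"
      using X by (auto simp: sos_paths_def PiE_iff)
  qed
qed (auto intro: finite_PiE)

definition Z_free :: "(nat \<Rightarrow> real) \<Rightarrow> nat \<Rightarrow> real" where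
  "Z_free b N = (\<Sum>X\<in>sos_paths N. (1/2) ^ N * (\<Prod>n=0..N. inverse (b (X n))))"

text \<open>The argument \<open>N\<close> of the bridge partition function stands for the length \<open>2N\<close>.\<close>

definition Z_bridge :: "(nat \<Rightarrow> real) \<Rightarrow> nat \<Rightarrow> real" where
  "Z_bridge b N = (\<Sum>X | X \<in> sos_paths (2 * N) \<and> X (2 * N) = 0.
     (1/2) ^ (2 * N) * (\<Prod>n=0..2 * N. inverse (b (X n))))"

text \<open>Existence of the limit is part of the following two predicates.\<close>

definition gibbs_potential_free :: "(nat \<Rightarrow> real) \<Rightarrow> real \<Rightarrow> bool" where
  "gibbs_potential_free b \<Phi> \<longleftrightarrow> (\<lambda>N. - (1 / real N) * ln (Z_free b N)) \<longlonglongrightarrow> \<Phi>"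

definition gibbs_potential_bridge :: "(nat \<Rightarrow> real) \<Rightarrow> real \<Rightarrow> bool" where
  "gibbs_potential_bridge b \<Phi> \<longleftrightarrow>
     (\<lambda>N. - (1 / real (2 * N)) * ln (Z_bridge b N)) \<longlonglongrightarrow> \<Phi>"

text \<open>
  Infinite matrices are functions of two indices together with an index set \<open>I\<close>. The matrix \<open>R\<close>
  is \<open>Q b\<close> on the index set \<open>{1..}\<close>, where \<open>b 0\<close> plays no role. All matrices considered here have
  rows of finite support, so the infinite sums below are finite.
\<close>

definition Q :: "(nat \<Rightarrow> real) \<Rightarrow> nat \<Rightarrow> nat \<Rightarrow> real" where
  "Q b p q = (if \<bar>int p - int q\<bar> = 1 then 1 / (2 * sqrt (b p * b q)) else 0)"

definition mat_vec :: "nat set \<Rightarrow> (nat \<Rightarrow> nat \<Rightarrow> real) \<Rightarrow> (nat \<Rightarrow> real) \<Rightarrow> nat \<Rightarrow> real" where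
  "mat_vec I M w p = (\<Sum>\<^sub>\<infinity>q\<in>I. M p q * w q)"

primrec mat_pow :: "nat set \<Rightarrow> (nat \<Rightarrow> nat \<Rightarrow> real) \<Rightarrow> nat \<Rightarrow> nat \<Rightarrow> nat \<Rightarrow> real" where
  "mat_pow I M 0 = (\<lambda>i j. if i = j then 1 else 0)"
| "mat_pow I M (Suc n) = (\<lambda>i j. \<Sum>\<^sub>\<infinity>k\<in>I. M i k * mat_pow I M n k j)"

definition rho_star :: "nat set \<Rightarrow> (nat \<Rightarrow> nat \<Rightarrow> real) \<Rightarrow> real" where
  "rho_star I M = (THE r. \<forall>i\<in>I. \<forall>j\<in>I. even (i + j) \<longrightarrow>
     (\<lambda>n. root (2 * n) (mat_pow I M (2 * n) i j)) \<longlonglongrightarrow> r)"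

text \<open>The value lies in the extended reals, where \<open>Inf {} = \<infinity>\<close>; the entry \<open>w 0\<close> is irrelevant.\<close>

definition w1 :: "(nat \<Rightarrow> real) \<Rightarrow> real \<Rightarrow> ereal" where
  "w1 b \<rho> = Inf {ereal (w 1) | w. (\<forall>p\<ge>1. w p > 0) \<and>
     (\<forall>p\<ge>1. mat_vec {1..} (Q b) w p = \<rho> * w p - (if p = 1 then 1 else 0))}"

definition b0c :: "(nat \<Rightarrow> real) \<Rightarrow> ereal" where
  "b0c b = Lim (at_right (rho_star {1..} (Q b))) (\<lambda>\<rho>. w1 b \<rho> / ereal (4 * b 1 * \<rho>))"

end

theory Submission
  imports Defs
begin

text \<open>
  For \<open>\<rho> > \<rho>\<^sub>*(R)\<close> the infimum \<open>w\<^sub>1(\<rho>)\<close> is the Green function \<open>\<Sum>\<^sub>n (R\<^sup>n)\<^sub>1\<^sub>1 \<rho>\<^bsup>-n-1\<^esup>\<close>, which is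
  continuous and strictly decreasing in \<open>\<rho>\<close>. Prepending one entry turns a positive supersolution for
  \<open>R\<close> into one for \<open>Q\<close> precisely if \<open>w\<^sub>1 / (4 \<rho> b\<^sub>1) \<le> b\<^sub>0\<close>, and \<open>\<rho>\<^sub>*\<close> is the smallest \<open>\<rho>\<close> that
  admits a positive supersolution; hence the crossing point of \<open>w\<^sub>1(\<rho>) / (4 \<rho> b\<^sub>1)\<close> with \<open>b\<^sub>0\<close> is
  \<open>\<rho>\<^sub>*(Q)\<close>. Above the critical value there is no crossing, so \<open>\<rho>\<^sub>*(Q) \<le> \<rho>\<^sub>*(R)\<close>, and finiteness of the
  Green function at \<open>\<rho>\<^sub>*(R)\<close> forces \<open>\<rho>\<^sub>*(R) = 1\<close>. Partition functions are sums of entries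
  of \<open>Q\<^sup>N\<close>, so both Gibbs potentials equal \<open>- ln \<rho>\<^sub>*(Q)\<close>.
\<close>

section \<open>Supermultiplicative sequences\<close>

lemma supermult_power_le:
  fixes c :: "nat \<Rightarrow> real"
  assumes pos: "\<And>n. c n > 0" and mult: "\<And>m n. c m * c n \<le> c (m + n)"
  shows "c m ^ q * c r \<le> c (q * m + r)"
proof (induction q)
  case (Suc q)
  have "c m ^ Suc q * c r = c m * (c m ^ q * c r)" by simp
  also have "\<dots> \<le> c m * c (q * m + r)"
    using Suc pos[of m] by (intro mult_left_mono) auto
  also have "\<dots> \<le> c (m + (q * m + r))" by (rule mult)
  finally show ?case by (simp add: add.assoc)
qed simp

text \<open>The n-th root of a positive constant tends to 1, so prefactors such as \<open>K\<close>
  and \<open>\<kappa>\<close> are invisible to the limit and rates arbitrarily close to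
  \<open>L\<close> suffice.\<close>

lemma root_tendsto_sandwich:
  fixes c :: "nat \<Rightarrow> real"
  assumes L: "L > 0"
    and upper: "\<And>t. L < t \<Longrightarrow> \<exists>K>0. eventually (\<lambda>n. c n \<le> K * t ^ n) sequentially"
    and lower: "\<And>s. 0 < s \<Longrightarrow> s < L \<Longrightarrow> \<exists>\<kappa>>0. eventually (\<lambda>n. \<kappa> * s ^ n \<le> c n) sequentially"
  shows "(\<lambda>n. root n (c n)) \<longlonglongrightarrow> L"
proof (rule order_tendstoI)
  have lim: "(\<lambda>n. root n \<kappa> * s) \<longlonglongrightarrow> s" if "\<kappa> > 0" for \<kappa> s :: real
    using tendsto_mult[OF LIMSEQ_root_const[OF that] tendsto_const[of s]] by simp
  have root_eq: "root n (\<kappa> * s ^ n) = root n \<kappa> * s" if "n > 0" "s > 0" for n and \<kappa> s :: real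
    using that by (simp add: real_root_mult real_root_power_cancel)
  fix a assume a: "a < L"
  obtain s where s: "max a 0 < s" "s < L" using dense[of "max a 0" L] a L by auto
  then obtain \<kappa> where \<kappa>: "\<kappa> > 0" "eventually (\<lambda>n. \<kappa> * s ^ n \<le> c n) sequentially"
    using lower[of s] by auto
  have "eventually (\<lambda>n. a < root n \<kappa> * s) sequentially"
    using order_tendstoD(1)[OF lim[OF \<kappa>(1), of s]] s by auto
  with \<kappa>(2) eventually_gt_at_top[of 0] show "eventually (\<lambda>n. a < root n (c n)) sequentially"
  proof eventually_elim
    case (elim n)
    then show ?case
      using real_root_le_mono[of n "\<kappa> * s ^ n" "c n"] root_eq[of n s \<kappa>] s by auto
  qed
next
  fix a assume "L < a"
  then obtain t where t: "L < t" "t < a" using dense by blast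
  then obtain K where K: "K > 0" "eventually (\<lambda>n. c n \<le> K * t ^ n) sequentially"
    using upper by blast
  have "(\<lambda>n. root n K * t) \<longlonglongrightarrow> t"
    using tendsto_mult[OF LIMSEQ_root_const[OF K(1)] tendsto_const[of t]] by simp
  then have "eventually (\<lambda>n. root n K * t < a) sequentially"
    using t(2) by (rule order_tendstoD(2))
  with K(2) eventually_gt_at_top[of 0] show "eventually (\<lambda>n. root n (c n) < a) sequentially"
  proof eventually_elim
    case (elim n)
    then have "root n (K * t ^ n) = root n K * t"
      using L t by (simp add: real_root_mult real_root_power_cancel)
    then show ?case
      using real_root_le_mono[of n "c n" "K * t ^ n"] elim by auto
  qed
qed

text \<open>Fekete's lemma, with \<open>L\<close> the supremum of the roots
  \<open>c n ^ (1/n)\<close>. It is phrased as two-sided exponential bounds because these can be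
  transferred to other sequences.\<close>

lemma supermult_root_tendsto:
  fixes c :: "nat \<Rightarrow> real"
  assumes pos: "\<And>n. c n > 0" and mult: "\<And>m n. c m * c n \<le> c (m + n)"
    and bound: "\<And>n. c n \<le> C ^ n"
  obtains L where "L > 0" "\<And>n. c n \<le> L ^ n"
    "\<And>s. 0 < s \<Longrightarrow> s < L \<Longrightarrow> \<exists>\<kappa>>0. \<forall>n. \<kappa> * s ^ n \<le> c n"
proof -
  define u where "u n = root (Suc n) (c (Suc n))" for n
  define L where "L = (SUP n. u n)"
  have C: "C > 0" using pos[of 1] bound[of 1] by simp
  have u_le: "u n \<le> C" for n
    using real_root_le_mono[of "Suc n", OF _ bound[of "Suc n"]] C
    unfolding u_def by (simp add: real_root_power_cancel del: power_Suc)
  have bdd: "bdd_above (range u)" using u_le unfolding bdd_above_def by blast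
  have u_L: "u n \<le> L" for n unfolding L_def using bdd by (intro cSUP_upper) auto
  have u_pos: "u n > 0" for n unfolding u_def using pos by simp
  have L: "L > 0" using u_pos[of 0] u_L[of 0] by linarith
  have u_pow: "u n ^ Suc n = c (Suc n)" for n
    unfolding u_def using pos[of "Suc n"] by (intro real_root_pow_pos2) auto
  \<comment> \<open>This settles \<open>n = 0\<close>, the only index not of the form
    \<open>Suc n\<close> covered by \<open>u\<close>.\<close>
  have "c 0 \<le> 1" using mult[of 0 0] pos[of 0] by simp
  then have le: "c n \<le> L ^ n" for n
    using power_mono[OF u_L[of "n - 1"], of n] u_pos[of "n - 1"] u_pow[of "n - 1"]
    by (cases n) auto
  have "\<exists>\<kappa>>0. \<forall>n. \<kappa> * s ^ n \<le> c n" if s: "0 < s" "s < L" for s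
  proof -
    obtain m where m: "s < u m" using s(2) unfolding L_def by (auto simp: less_cSUP_iff[OF _ bdd])
    define h where "h r = c r / s ^ r" for r
    \<comment> \<open>Writing n = q(m+1) + r, the block of q(m+1) steps already grows faster than
      \<open>s\<close>; \<open>\<kappa>\<close> absorbs the finitely many possible remainders
      r.\<close>
    define \<kappa> where "\<kappa> = Min (h ` {..m})"
    have \<kappa>: "\<kappa> > 0" unfolding \<kappa>_def h_def using pos s by (subst Min_gr_iff) auto
    have "\<kappa> * s ^ n \<le> c n" for n
    proof -
      define q r where "q = n div Suc m" and "r = n mod Suc m"
      have n: "n = q * Suc m + r" unfolding q_def r_def by (metis div_mult_mod_eq)
      have "\<kappa> \<le> h r" unfolding \<kappa>_def r_def using mod_less_divisor[of "Suc m" n]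
        by (intro Min_le) (auto simp: less_Suc_eq_le simp del: mod_less_divisor)
      then have "\<kappa> * s ^ r \<le> c r" unfolding h_def using s by (simp add: field_simps)
      moreover have "(s ^ Suc m) ^ q \<le> c (Suc m) ^ q"
        using m s u_pow[of m] power_mono[of s "u m" "Suc m"] by (intro power_mono) auto
      ultimately have "(s ^ Suc m) ^ q * (\<kappa> * s ^ r) \<le> c (Suc m) ^ q * c r"
        using s \<kappa> pos[of "Suc m"] by (intro mult_mono) auto
      also have "\<dots> \<le> c n" using n supermult_power_le[OF pos mult, of "Suc m" q r] by simp
      finally have "(s ^ Suc m) ^ q * (\<kappa> * s ^ r) \<le> c n" .
      moreover have "s ^ n = (s ^ Suc m) ^ q * s ^ r"
        by (subst n) (simp only: power_add power_mult[symmetric] mult.commute[of q])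
      ultimately show ?thesis by (simp add: mult.left_commute del: power_Suc)
    qed
    with \<kappa> show ?thesis by blast
  qed
  with L le show thesis by (rule that)
qed

section \<open>Powers of a Jacobi matrix\<close>

text \<open>The index set is \<open>{k..}\<close>: the matrix \<open>Q\<close> is the case \<open>k = 0\<close> and \<open>R\<close> the case \<open>k = 1\<close>.\<close>

locale jacobi =
  fixes M :: "nat \<Rightarrow> nat \<Rightarrow> real" and k :: nat
  assumes sym: "M p q = M q p"
    and supp: "\<not> (q = Suc p \<or> p = Suc q) \<Longrightarrow> M p q = 0"
    and pos: "M p (Suc p) > 0"
    and bdd: "bdd_above (range (\<lambda>p. M p (Suc p)))"
begin

definition B :: real where "B = (SUP p. M p (Suc p))"

abbreviation "mv \<equiv> mat_vec {k..} M"
abbreviation "mp \<equiv> mat_pow {k..} M"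

lemma pos': "M (Suc p) p > 0"
  using pos sym by simp

lemma nonneg: "M p q \<ge> 0"
  using pos[of p] pos'[of q] supp[of q p] by (cases "q = Suc p \<or> p = Suc q") auto

lemma bounded_Suc: "M p (Suc p) \<le> B"
  unfolding B_def using bdd by (intro cSUP_upper) auto

lemma B_pos: "B > 0"
  using pos[of 0] bounded_Suc[of 0] by simp

lemma bounded: "M p q \<le> B"
  using bounded_Suc[of p] bounded_Suc[of q] sym[of p q] supp[of q p] B_pos
  by (cases "q = Suc p \<or> p = Suc q") auto

lemma infsum_row: "(\<Sum>\<^sub>\<infinity>q\<in>{k..}. M p q * w q) = (\<Sum>q=k..Suc p. M p q * w q)"
proof -
  have "(\<Sum>\<^sub>\<infinity>q\<in>{k..}. M p q * w q) = (\<Sum>\<^sub>\<infinity>q\<in>{k..Suc p}. M p q * w q)"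
    by (rule infsum_cong_neutral) (auto intro: supp)
  then show ?thesis by simp
qed

lemma mv_eq: "mv w p = (\<Sum>q=k..Suc p. M p q * w q)"
  unfolding mat_vec_def by (rule infsum_row)

lemma mv_bot: "mv w k = M k (Suc k) * w (Suc k)"
  unfolding mv_eq using supp[of k k] by simp

lemma mv_Suc:
  assumes "p \<ge> k"
  shows "mv w (Suc p) = M (Suc p) p * w p + M (Suc p) (Suc (Suc p)) * w (Suc (Suc p))"
proof -
  have "mv w (Suc p) = (\<Sum>q\<in>{p, Suc (Suc p)}. M (Suc p) q * w q)"
    unfolding mv_eq using assms by (intro sum.mono_neutral_right) (auto intro!: supp)
  then show ?thesis by simp
qed

lemma mp_Suc: "mp (Suc n) i j = mv (\<lambda>q. mp n q j) i"
  by (simp add: mat_vec_def)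

lemma mp_Suc_sum: "mp (Suc n) i j = (\<Sum>q=k..Suc i. M i q * mp n q j)"
  by (simp add: infsum_row)

declare mat_pow.simps(2) [simp del]

lemma mv_mono: "(\<And>q. q \<ge> k \<Longrightarrow> v q \<le> w q) \<Longrightarrow> mv v p \<le> mv w p"
  unfolding mv_eq by (intro sum_mono mult_left_mono nonneg) auto

lemma mv_add: "mv (\<lambda>q. v q + w q) p = mv v p + mv w p"
  by (simp add: mv_eq algebra_simps sum.distrib)

lemma mv_diff: "mv (\<lambda>q. v q - w q) p = mv v p - mv w p"
  by (simp add: mv_eq algebra_simps sum_subtractf)

lemma mv_scale: "mv (\<lambda>q. c * w q) p = c * mv w p"
  by (simp add: mv_eq algebra_simps sum_distrib_left)

text \<open>A row has at most two nonzero entries, each at most \<open>B\<close>; the bottom row has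
  only one.\<close>

lemma mv_const:
  assumes "p \<ge> k" "c \<ge> 0"
  shows "mv (\<lambda>_. c) p \<le> 2 * B * c"
proof (cases "p = k")
  case True
  have "M k (Suc k) * c \<le> B * c" "0 \<le> B * c"
    using bounded assms(2) B_pos by (auto intro: mult_right_mono)
  then show ?thesis unfolding True mv_bot by linarith
next
  case False
  with assms(1) obtain p' where p': "p = Suc p'" "p' \<ge> k" by (cases p) auto
  have "M p q * c \<le> B * c" for q using bounded assms(2) by (intro mult_right_mono)
  from this[of p'] this[of "Suc p"] show ?thesis using p' by (simp add: mv_Suc)
qed

lemma mv_nonneg: "(\<And>q. q \<ge> k \<Longrightarrow> w q \<ge> 0) \<Longrightarrow> mv w p \<ge> 0"
  unfolding mv_eq by (intro sum_nonneg mult_nonneg_nonneg nonneg) auto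

lemma mv_pos:
  assumes "\<And>q. q \<ge> k \<Longrightarrow> w q \<ge> 0" "p \<ge> k" "q \<ge> k" "q = Suc p \<or> p = Suc q" "w q > 0"
  shows "mv w p > 0"
proof -
  have "0 < M p q * w q" using assms(4,5) pos pos' by auto
  also have "\<dots> \<le> mv w p"
    unfolding mv_eq using assms by (intro member_le_sum mult_nonneg_nonneg nonneg) auto
  finally show ?thesis .
qed

lemma mp_nonneg: "mp n i j \<ge> 0"
  by (induction n arbitrary: i) (auto simp: mp_Suc intro!: mv_nonneg)

text \<open>Powers are weighted path sums with nonnegative weights, and the paths that visit
  \<open>l\<close> at time \<open>m\<close> are only some of the paths from \<open>i\<close> to
  \<open>j\<close>.\<close>

lemma mp_mult_le:
  assumes "l \<ge> k"
  shows "mp m i l * mp n l j \<le> mp (m + n) i j"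
proof (induction m arbitrary: i)
  case 0
  then show ?case by (auto simp: mp_nonneg)
next
  case (Suc m)
  have "mp (Suc m) i l * mp n l j = mv (\<lambda>q. mp m q l * mp n l j) i"
    by (simp only: mp_Suc mv_eq sum_distrib_right mult.assoc)
  also have "\<dots> \<le> mv (\<lambda>q. mp (m + n) q j) i" by (intro mv_mono Suc)
  finally show ?case by (simp add: mp_Suc)
qed

lemma mp_1:
  assumes "j \<ge> k"
  shows "mp (Suc 0) i j = M i j"
proof -
  have "mp (Suc 0) i j = (\<Sum>q=k..Suc i. if q = j then M i q else 0)"
    unfolding mp_Suc_sum by (intro sum.cong) auto
  also have "\<dots> = (if j \<in> {k..Suc i} then M i j else 0)"
    by (rule sum.delta) simp
  finally show ?thesis using assms supp[of j i] by auto
qed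

text \<open>\<open>mat_pow\<close> splits off the first step of a path; symmetry and the recursion
  for partition functions need the last step split off instead.\<close>

lemma mp_Suc_right:
  assumes "i \<ge> k" "j \<ge> k"
  shows "mp (Suc n) i j = (\<Sum>l=k..Suc j. mp n i l * M l j)"
using assms(1)
proof (induction n arbitrary: i)
  case 0
  show ?case
  proof (cases "i \<in> {k..Suc j}")
    case True
    have "(\<Sum>l=k..Suc j. mp 0 i l * M l j) = (\<Sum>l=k..Suc j. if i = l then M l j else 0)"
      by (intro sum.cong) auto
    also have "\<dots> = (if i \<in> {k..Suc j} then M i j else 0)"
      by (rule sum.delta') simp
    finally show ?thesis using mp_1[OF assms(2)] True by auto
  next
    case False
    then show ?thesis using mp_1[OF assms(2), of i] supp[of j i] assms(2) 0 by (cases "j = Suc i") auto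
  qed
next
  case (Suc n)
  have "mp (Suc (Suc n)) i j = (\<Sum>q=k..Suc i. \<Sum>l=k..Suc j. M i q * mp n q l * M l j)"
    by (subst mp_Suc_sum, intro sum.cong refl, subst Suc.IH)
       (auto simp: sum_distrib_left mult.assoc simp del: sum.cl_ivl_Suc)
  also have "\<dots> = (\<Sum>l=k..Suc j. mp (Suc n) i l * M l j)"
    by (subst sum.swap) (simp add: mp_Suc_sum sum_distrib_right mult.assoc del: sum.cl_ivl_Suc)
  finally show ?case .
qed

lemma mp_sym:
  assumes "i \<ge> k" "j \<ge> k"
  shows "mp n i j = mp n j i"
  using assms
proof (induction n arbitrary: i j)
  case (Suc n)
  have "mp (Suc n) i j = (\<Sum>q=k..Suc i. M i q * mp n q j)" by (rule mp_Suc_sum)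
  also have "\<dots> = (\<Sum>q=k..Suc i. mp n j q * M q i)"
    using Suc by (intro sum.cong) (auto simp: sym[of i])
  also have "\<dots> = mp (Suc n) j i" using Suc.prems by (simp only: mp_Suc_right)
  finally show ?case .
qed simp

text \<open>The path descending straight from \<open>k + n\<close> to \<open>k\<close> has positive
  weight.\<close>

lemma mp_bot_pos: "mp n (k + n) k > 0"
proof (induction n)
  case (Suc n)
  have "0 < M (k + Suc n) (k + n) * mp n (k + n) k" using Suc pos' by simp
  also have "\<dots> = mp (Suc 0) (k + Suc n) (k + n) * mp n (k + n) k" by (simp only: mp_1 le_add1)
  also have "\<dots> \<le> mp (Suc 0 + n) (k + Suc n) k" by (rule mp_mult_le) simp
  finally show ?case by simp
qed simp

lemma mp_bot_pos':
  assumes "i \<ge> k"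
  shows "mp (i - k) i k > 0" "mp (i - k) k i > 0"
  using mp_bot_pos[of "i - k"] mp_sym[of i k] assms by auto

lemma mp_le_bound:
  assumes "p \<ge> k"
  shows "mp n p j \<le> (2 * B) ^ n"
  using assms
proof (induction n arbitrary: p)
  case (Suc n)
  have "mp (Suc n) p j \<le> mv (\<lambda>_. (2 * B) ^ n) p"
    unfolding mp_Suc using Suc.IH by (intro mv_mono) auto
  also have "\<dots> \<le> 2 * B * (2 * B) ^ n"
    using Suc.prems B_pos by (intro mv_const) auto
  finally show ?case by simp
qed simp

text \<open>By symmetry the square is the weight of going to \<open>j\<close> in \<open>n\<close>
  steps and returning in \<open>n\<close> steps.\<close>

lemma mp_square_le:
  assumes "i \<ge> k" "j \<ge> k"
  shows "(mp n i j)\<^sup>2 \<le> mp (2 * n) i i"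
  using mp_mult_le[of j n i n i] mp_sym[of j i n] assms by (simp add: power2_eq_square mult_2)

lemma mp_even_pos: "mp (2 * n) k k > 0"
proof (induction n)
  case (Suc n)
  have "0 < mp (Suc 0) k (Suc k)" using pos by (simp add: mp_1)
  then have "0 < mp (Suc 0) k (Suc k) ^ 2" by simp
  also have "\<dots> \<le> mp 2 k k" using mp_square_le[of k "Suc k" "Suc 0"] by simp
  finally have "0 < mp 2 k k" .
  then have "0 < mp 2 k k * mp (2 * n) k k" using Suc by simp
  also have "\<dots> \<le> mp (2 + 2 * n) k k" by (rule mp_mult_le) simp
  finally show ?case by simp
qed simp

section \<open>The growth rate\<close>

text \<open>Straight paths from \<open>k\<close> to \<open>i\<close> and from \<open>j\<close> to
  \<open>k\<close> turn a path from \<open>i\<close> to \<open>j\<close> into a loop at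
  \<open>k\<close>; their weights do not depend on \<open>n\<close>. With \<open>bot_le_mp\<close>
  this makes all entries grow at the rate of the corner entry.\<close>

lemma mp_le_bot:
  assumes "i \<ge> k" "j \<ge> k"
  shows "mp (i - k) k i * mp n i j * mp (j - k) j k \<le> mp (i - k + n + (j - k)) k k"
proof -
  have "mp (i - k) k i * mp n i j * mp (j - k) j k \<le> mp (i - k + n) k j * mp (j - k) j k"
    using assms by (intro mult_right_mono mp_mult_le mp_nonneg) auto
  also have "\<dots> \<le> mp (i - k + n + (j - k)) k k" by (rule mp_mult_le[OF assms(2)])
  finally show ?thesis .
qed

lemma bot_le_mp:
  assumes "i \<ge> k" "j \<ge> k"
  shows "mp (i - k) i k * mp n k k * mp (j - k) k j \<le> mp (i - k + n + (j - k)) i j"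
proof -
  have "mp (i - k) i k * mp n k k * mp (j - k) k j \<le> mp (i - k + n) i k * mp (j - k) k j"
    by (intro mult_right_mono mp_mult_le mp_nonneg) auto
  also have "\<dots> \<le> mp (i - k + n + (j - k)) i j" by (intro mp_mult_le) auto
  finally show ?thesis .
qed

abbreviation "\<rho>\<^sub>s \<equiv> rho_star {k..} M"

lemma rho_star_ex:
  obtains r where "r > 0" "\<And>n. mp n k k \<le> r ^ n"
    "\<And>i j. i \<ge> k \<Longrightarrow> j \<ge> k \<Longrightarrow> even (i + j) \<Longrightarrow> (\<lambda>n. root (2 * n) (mp (2 * n) i j)) \<longlonglongrightarrow> r"
proof -
  \<comment> \<open>Fekete's lemma needs positive terms, and returns to \<open>k\<close> at odd
    times have weight zero.\<close>
  define c where "c n = mp (2 * n) k k" for n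
  have "c n \<le> ((2 * B)\<^sup>2) ^ n" for n
    using mp_le_bound[of k "2 * n" k] by (simp add: c_def power_mult)
  moreover have "c m * c n \<le> c (m + n)" for m n
    using mp_mult_le[of k "2 * m" k "2 * n" k] by (simp add: c_def algebra_simps)
  ultimately obtain L where L: "L > 0" and upper: "\<And>n. c n \<le> L ^ n"
    and lower: "\<And>s. 0 < s \<Longrightarrow> s < L \<Longrightarrow> \<exists>\<kappa>>0. \<forall>n. \<kappa> * s ^ n \<le> c n"
    using supermult_root_tendsto[of c "(2 * B)\<^sup>2"] mp_even_pos unfolding c_def by blast
  \<comment> \<open>\<open>L\<close> is the rate per two steps, \<open>r\<close> the rate per
    step.\<close>
  define r where "r = sqrt L"
  have r: "r > 0" "r ^ 2 = L" using L by (auto simp: r_def)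
  have bot: "mp n k k \<le> r ^ n" for n
  proof (rule power2_le_imp_le)
    have "(mp n k k)\<^sup>2 \<le> L ^ n"
      using mp_square_le[of k k n] upper[of n] by (simp add: c_def)
    also have "\<dots> = (r ^ n)\<^sup>2" unfolding r(2)[symmetric] by (simp add: power_mult[symmetric] mult.commute)
    finally show "(mp n k k)\<^sup>2 \<le> (r ^ n)\<^sup>2" .
  qed (use r in auto)
  have "(\<lambda>n. root (2 * n) (mp (2 * n) i j)) \<longlonglongrightarrow> r" if ij: "i \<ge> k" "j \<ge> k" "even (i + j)" for i j
  proof -
    \<comment> \<open>The parity assumption makes the two connecting paths have even total length,
      so that they shift the even-time sequence \<open>c\<close> by \<open>h\<close> places.\<close>
    define h where "h = (i - k + (j - k)) div 2"
    have h: "i - k + (j - k) = 2 * h" unfolding h_def using ij by simp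
    define \<mu> where "\<mu> = mp (i - k) k i * mp (j - k) j k"
    define \<nu> where "\<nu> = mp (i - k) i k * mp (j - k) k j"
    have \<mu>: "\<mu> > 0" and \<nu>: "\<nu> > 0" unfolding \<mu>_def \<nu>_def using mp_bot_pos' ij by auto
    have "(\<lambda>n. root n (mp (2 * n) i j)) \<longlonglongrightarrow> L"
    proof (rule root_tendsto_sandwich)
      fix t assume t: "L < t"
      have "mp (2 * n) i j \<le> (L ^ h / \<mu>) * t ^ n" for n
      proof -
        have len: "i - k + 2 * n + (j - k) = 2 * (n + h)" using h by simp
        have "\<mu> * mp (2 * n) i j \<le> c (n + h)"
          using mp_le_bot[OF ij(1,2), of "2 * n"] unfolding len c_def \<mu>_def by (simp only: mult_ac)
        also have "\<dots> \<le> L ^ (n + h)" by (rule upper)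
        finally have "mp (2 * n) i j \<le> (L ^ h / \<mu>) * L ^ n"
          using \<mu> by (simp add: field_simps power_add)
        also have "\<dots> \<le> (L ^ h / \<mu>) * t ^ n"
          using t L \<mu> by (intro mult_left_mono power_mono) auto
        finally show ?thesis .
      qed
      then show "\<exists>K>0. eventually (\<lambda>n. mp (2 * n) i j \<le> K * t ^ n) sequentially"
        using L \<mu> by (intro exI[of _ "L ^ h / \<mu>"]) auto
    next
      fix s assume s: "0 < s" "s < L"
      then obtain \<kappa> where \<kappa>: "\<kappa> > 0" "\<And>n. \<kappa> * s ^ n \<le> c n" using lower by blast
      have "(\<nu> * \<kappa> / s ^ h) * s ^ n \<le> mp (2 * n) i j" if "n \<ge> h" for n
      proof -
        have "i - k + 2 * (n - h) + (j - k) = 2 * n" using h that by simp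
        then have "\<nu> * c (n - h) \<le> mp (2 * n) i j"
          using bot_le_mp[OF ij(1,2), of "2 * (n - h)"] by (simp add: c_def \<nu>_def mult_ac)
        moreover have "\<nu> * (\<kappa> * s ^ (n - h)) \<le> \<nu> * c (n - h)"
          using \<kappa>(2) \<nu> by (intro mult_left_mono) auto
        moreover have "s ^ (n - h) = s ^ n / s ^ h" using s that by (simp add: power_diff)
        ultimately show ?thesis by (simp add: mult.assoc)
      qed
      then show "\<exists>\<kappa>>0. eventually (\<lambda>n. \<kappa> * s ^ n \<le> mp (2 * n) i j) sequentially"
        using \<kappa> \<nu> s by (intro exI[of _ "\<nu> * \<kappa> / s ^ h"]) (auto simp: eventually_sequentially)
    qed (rule L)
    then show ?thesis
      unfolding r_def real_root_mult_exp sqrt_def by (intro tendsto_real_root)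
  qed
  with r(1) bot show thesis by (rule that)
qed

lemma rho_star_unique:
  assumes "\<And>i j. i \<ge> k \<Longrightarrow> j \<ge> k \<Longrightarrow> even (i + j) \<Longrightarrow> (\<lambda>n. root (2 * n) (mp (2 * n) i j)) \<longlonglongrightarrow> r"
  shows "\<rho>\<^sub>s = r"
  unfolding rho_star_def
proof (rule the_equality)
  fix s assume "\<forall>i\<in>{k..}. \<forall>j\<in>{k..}. even (i + j) \<longrightarrow> (\<lambda>n. root (2 * n) (mp (2 * n) i j)) \<longlonglongrightarrow> s"
  then have "(\<lambda>n. root (2 * n) (mp (2 * n) k k)) \<longlonglongrightarrow> s" by auto
  then show "s = r" using assms[of k k] LIMSEQ_unique by auto
qed (use assms in auto)

lemma rho_star_pos: "\<rho>\<^sub>s > 0"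
  and mp_bot_le: "mp n k k \<le> \<rho>\<^sub>s ^ n"
  and root_tendsto_rho_star: "(\<lambda>n. root (2 * n) (mp (2 * n) k k)) \<longlonglongrightarrow> \<rho>\<^sub>s"
proof -
  obtain r where r: "r > 0" "\<And>n. mp n k k \<le> r ^ n"
    "\<And>i j. i \<ge> k \<Longrightarrow> j \<ge> k \<Longrightarrow> even (i + j) \<Longrightarrow> (\<lambda>n. root (2 * n) (mp (2 * n) i j)) \<longlonglongrightarrow> r"
    by (rule rho_star_ex) blast
  moreover from this(3) have "\<rho>\<^sub>s = r" by (rule rho_star_unique)
  ultimately show "\<rho>\<^sub>s > 0" "mp n k k \<le> \<rho>\<^sub>s ^ n" "(\<lambda>n. root (2 * n) (mp (2 * n) k k)) \<longlonglongrightarrow> \<rho>\<^sub>s"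
    by auto
qed

text \<open>Iterating the supersolution inequality from a multiple of the indicator of
  \<open>k\<close> dominated by \<open>v\<close> bounds column \<open>k\<close> of the n-th power by
  \<open>s ^ n * v / v k\<close>.\<close>

lemma rho_star_le:
  assumes "\<And>p. p \<ge> k \<Longrightarrow> v p > 0" "\<And>p. p \<ge> k \<Longrightarrow> mv v p \<le> s * v p"
  shows "\<rho>\<^sub>s \<le> s"
proof -
  have "0 < mv v k" using assms(1) by (intro mv_pos[of _ k "Suc k"]) (auto simp: less_imp_le)
  then have s: "s > 0" using assms(1,2)[of k] by (auto simp: zero_less_mult_iff dest: order.strict_trans2)
  have le: "mp n p k * v k \<le> s ^ n * v p" if "p \<ge> k" for n p
    using that
  proof (induction n arbitrary: p)
    case 0
    then show ?case using assms(1) by (auto simp: less_imp_le)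
  next
    case (Suc n)
    have "mp (Suc n) p k * v k = mv (\<lambda>q. v k * mp n q k) p"
      by (simp add: mp_Suc mv_scale mult.commute)
    also have "\<dots> \<le> mv (\<lambda>q. s ^ n * v q) p"
      using Suc.IH by (intro mv_mono) (auto simp: mult.commute)
    also have "\<dots> \<le> s ^ n * (s * v p)"
      unfolding mv_scale using assms(2)[OF Suc.prems] s by (intro mult_left_mono) auto
    finally show ?case by (simp add: mult_ac)
  qed
  have "root (2 * n) (mp (2 * n) k k) \<le> s" if "n \<ge> 1" for n
  proof -
    have "mp (2 * n) k k \<le> s ^ (2 * n)" using le[of k "2 * n"] assms(1)[of k] by simp
    then have "root (2 * n) (mp (2 * n) k k) \<le> root (2 * n) (s ^ (2 * n))"
      using that by (intro real_root_le_mono) auto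
    then show ?thesis using s that by (simp add: real_root_power_cancel del: power_mult)
  qed
  then show ?thesis
    using root_tendsto_rho_star by (intro LIMSEQ_le_const2[of _ _ s]) auto
qed

section \<open>The Green function\<close>

text \<open>Neumann series of column \<open>k\<close> of the resolvent of \<open>M\<close> at
  \<open>s\<close>. It is meaningful only when it converges; \<open>green_finite\<close> tests this
  at the corner alone, and \<open>summable_green\<close> extends it to all rows.\<close>

definition green :: "real \<Rightarrow> nat \<Rightarrow> real" where
  "green s p = (\<Sum>n. mp n p k / s ^ Suc n)"

definition green_finite :: "real \<Rightarrow> bool" where
  "green_finite s \<longleftrightarrow> summable (\<lambda>n. mp n k k / s ^ Suc n)"

lemma green_finite_above:
  assumes "\<rho>\<^sub>s < s"
  shows "green_finite s"
  unfolding green_finite_def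
proof (rule summable_comparison_test')
  have s: "s > 0" using assms rho_star_pos by simp
  have "summable (\<lambda>n. (\<rho>\<^sub>s / s) ^ n)"
    using assms rho_star_pos by (intro summable_geometric) auto
  then show "summable (\<lambda>n. (\<rho>\<^sub>s / s) ^ n * (1 / s))" by (rule summable_mult2)
  fix n
  have "mp n k k / s ^ Suc n \<le> \<rho>\<^sub>s ^ n / s ^ Suc n"
    using s mp_bot_le by (intro divide_right_mono) auto
  then show "norm (mp n k k / s ^ Suc n) \<le> (\<rho>\<^sub>s / s) ^ n * (1 / s)"
    using s mp_nonneg by (simp add: power_divide mult.commute)
qed

context
  fixes s :: real
  assumes s: "s > 0" and finite: "green_finite s"
begin

lemma summable_green:
  assumes "p \<ge> k"
  shows "summable (\<lambda>n. mp n p k / s ^ Suc n)"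
proof (rule summable_comparison_test')
  define h where "h = p - k"
  define \<mu> where "\<mu> = mp h k p"
  have \<mu>: "\<mu> > 0" unfolding \<mu>_def h_def using mp_bot_pos' assms by simp
  show "summable (\<lambda>n. (s ^ h / \<mu>) * (mp (n + h) k k / s ^ Suc (n + h)))"
    using finite unfolding green_finite_def
    by (intro summable_mult) (rule summable_ignore_initial_segment)
  fix n
  \<comment> \<open>Prefixing the straight path from \<open>k\<close> to \<open>p\<close> yields a
    loop at \<open>k\<close> that is \<open>h\<close> steps longer.\<close>
  have "\<mu> * mp n p k \<le> mp (n + h) k k"
    unfolding \<mu>_def using mp_mult_le[OF assms, of h k n k] by (simp add: add.commute)
  then have "mp n p k / s ^ Suc n \<le> (mp (n + h) k k / \<mu>) / s ^ Suc n"
    using s \<mu> by (intro divide_right_mono) (auto simp: field_simps)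
  also have "\<dots> = (s ^ h / \<mu>) * (mp (n + h) k k / s ^ Suc (n + h))"
    using s \<mu> by (simp add: power_add)
  finally show "norm (mp n p k / s ^ Suc n) \<le> (s ^ h / \<mu>) * (mp (n + h) k k / s ^ Suc (n + h))"
    using s mp_nonneg by simp
qed

lemma green_pos:
  assumes "p \<ge> k"
  shows "green s p > 0"
  unfolding green_def
proof (rule suminf_pos2[OF summable_green[OF assms]])
  show "mp (p - k) p k / s ^ Suc (p - k) > 0" using s mp_bot_pos' assms by simp
qed (use s mp_nonneg in auto)

text \<open>Applying \<open>M\<close> shifts the series by one term; the lost term
  \<open>n = 0\<close> is the source at \<open>k\<close>.\<close>

lemma mv_green:
  assumes "p \<ge> k"
  shows "mv (green s) p = s * green s p - (if p = k then 1 else 0)"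
proof -
  have green: "(\<lambda>n. mp n q k / s ^ Suc n) sums green s q" if "q \<ge> k" for q
    unfolding green_def using summable_green[OF that] by (rule summable_sums)
  have "(\<lambda>n. \<Sum>q=k..Suc p. M p q * (mp n q k / s ^ Suc n)) sums mv (green s) p"
    unfolding mv_eq by (intro sums_sum sums_mult green) auto
  also have "(\<lambda>n. \<Sum>q=k..Suc p. M p q * (mp n q k / s ^ Suc n)) = (\<lambda>n. mp (Suc n) p k / s ^ Suc n)"
    by (simp only: mp_Suc_sum sum_divide_distrib times_divide_eq_right)
  finally have "(\<lambda>n. mp n p k / s ^ n) sums (mv (green s) p + mp 0 p k / s ^ 0)"
    by (rule sums_Suc_iff[THEN iffD1, rotated -1])
  moreover have "(\<lambda>n. mp n p k / s ^ n) sums (s * green s p)"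
    using sums_mult[OF green[OF assms], of s] s by simp
  ultimately have "mv (green s) p + mp 0 p k / s ^ 0 = s * green s p" by (rule sums_unique2)
  then show ?thesis by (auto split: if_splits)
qed

end

text \<open>Iterating \<open>w = (\<delta>\<^sub>k + M w) / s\<close> shows that the Green function is the minimal solution.\<close>

lemma green_minimal:
  assumes s: "s > 0" and w: "\<And>p. p \<ge> k \<Longrightarrow> w p \<ge> 0"
    and le: "\<And>p. p \<ge> k \<Longrightarrow> mv w p \<le> s * w p - (if p = k then 1 else 0)"
  shows "green_finite s" "green s k \<le> w k"
proof -
  have part: "(\<Sum>n<m. mp n p k / s ^ Suc n) \<le> w p" if "p \<ge> k" for m p
    using that
  proof (induction m arbitrary: p)
    case 0
    then show ?case using w by simp
  next
    case (Suc m)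
    have "s * (\<Sum>n<Suc m. mp n p k / s ^ Suc n) = (\<Sum>n<Suc m. mp n p k / s ^ n)"
      unfolding sum_distrib_left using s by (intro sum.cong) auto
    also have "\<dots> = (if p = k then 1 else 0) + (\<Sum>n<m. mp (Suc n) p k / s ^ Suc n)"
      unfolding sum.lessThan_Suc_shift by simp
    also have "(\<Sum>n<m. mp (Suc n) p k / s ^ Suc n) = (\<Sum>n<m. \<Sum>q=k..Suc p. M p q * (mp n q k / s ^ Suc n))"
      by (simp only: mp_Suc_sum sum_divide_distrib times_divide_eq_right)
    also have "\<dots> = mv (\<lambda>q. \<Sum>n<m. mp n q k / s ^ Suc n) p"
      by (subst sum.swap) (simp only: mv_eq sum_distrib_left)
    also have "\<dots> \<le> mv w p" using Suc.IH by (intro mv_mono)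
    also have "(if p = k then 1 else 0) + mv w p \<le> s * w p" using le[OF Suc.prems] by simp
    finally show ?case using s by simp
  qed
  have nonneg: "0 \<le> mp n k k / s ^ Suc n" for n using s mp_nonneg by simp
  show fin: "green_finite s"
    unfolding green_finite_def using part[of k] by (intro summableI_nonneg_bounded[of _ "w k"] nonneg) simp
  then show "green s k \<le> w k"
    unfolding green_def green_finite_def using part[of k] by (intro suminf_le_const) auto
qed

lemma green_finite_mono:
  assumes "s > 0" "green_finite s" "s \<le> t"
  shows "green_finite t" "green t k \<le> green s k" "s < t \<Longrightarrow> green t k < green s k"
proof -
  have le: "mp n k k / t ^ Suc n \<le> mp n k k / s ^ Suc n" for n
    using assms mp_nonneg by (intro divide_left_mono power_mono mult_pos_pos) auto
  show fin: "green_finite t"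
    using assms(2) unfolding green_finite_def
    by (rule summable_comparison_test') (use le mp_nonneg assms in \<open>auto simp del: power_Suc\<close>)
  then show "green t k \<le> green s k"
    using assms(2) unfolding green_def green_finite_def by (intro suminf_le le)
  show "green t k < green s k" if "s < t"
  proof -
    have "0 < (\<Sum>n. mp n k k / s ^ Suc n - mp n k k / t ^ Suc n)"
    proof (rule suminf_pos2)
      show "summable (\<lambda>n. mp n k k / s ^ Suc n - mp n k k / t ^ Suc n)"
        using fin assms(2) unfolding green_finite_def by (intro summable_diff)
      \<comment> \<open>Strictness comes from the term \<open>n = 0\<close>, where the matrix entry
        is 1.\<close>
      show "0 < mp 0 k k / s ^ Suc 0 - mp 0 k k / t ^ Suc 0" using that assms(1) by (simp add: field_simps)
    qed (use le in simp)
    then show ?thesis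
      using fin assms(2) unfolding green_def green_finite_def by (simp add: suminf_diff[symmetric])
  qed
qed

text \<open>In the variable \<open>1 / s\<close> the Green function is \<open>1 / s\<close> times a
  power series, which converges at the larger point \<open>1 / t\<close> for any \<open>t\<close>
  between \<open>\<rho>\<^sub>s\<close> and \<open>s\<close>.\<close>

lemma isCont_green:
  assumes "\<rho>\<^sub>s < s"
  shows "isCont (\<lambda>t. green t k) s"
proof -
  define P where "P x = (\<Sum>n. mp n k k * x ^ n)" for x
  have powser_term: "mp n k k * (1 / u) ^ n = u * (mp n k k / u ^ Suc n)" if "u > 0" for n u
    using that by (simp add: power_one_over)
  have summable: "summable (\<lambda>n. mp n k k * (1 / u) ^ n)" and green_P: "green u k = 1 / u * P (1 / u)"
    if "\<rho>\<^sub>s < u" for u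
  proof -
    have u: "u > 0" using that rho_star_pos by simp
    have fin: "summable (\<lambda>n. mp n k k / u ^ Suc n)"
      using green_finite_above[OF that] unfolding green_finite_def .
    show "summable (\<lambda>n. mp n k k * (1 / u) ^ n)"
      unfolding powser_term[OF u] using fin by (rule summable_mult)
    have "P (1 / u) = u * green u k"
      unfolding P_def powser_term[OF u] green_def using fin by (rule suminf_mult)
    then show "green u k = 1 / u * P (1 / u)" using u by simp
  qed
  obtain t where t: "\<rho>\<^sub>s < t" "t < s" using dense assms by blast
  have pos: "0 < t" "0 < s" using t rho_star_pos by auto
  then have "1 / s < 1 / t" using t by (simp add: frac_less2)
  then have "isCont P (1 / s)"
    unfolding P_def using pos by (intro isCont_powser[OF summable[OF t(1)]]) simp
  moreover have inv: "isCont (\<lambda>u. 1 / u) s" using pos by (intro continuous_intros) auto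
  ultimately have "isCont (\<lambda>u. P (1 / u)) s" by (intro isCont_o2[where f = "\<lambda>u. 1 / u" and g = P])
  with inv have "isCont (\<lambda>u. 1 / u * P (1 / u)) s" by (rule isCont_mult)
  moreover have "eventually (\<lambda>u. green u k = 1 / u * P (1 / u)) (nhds s)"
    using eventually_nhds_in_open[of "{\<rho>\<^sub>s<..}" s] assms by (auto elim!: eventually_mono simp: green_P)
  ultimately show ?thesis by (subst isCont_cong)
qed

section \<open>Comparison of the growth rate with 1 when the off-diagonal entries tend to
  1/2\<close>

lemma rho_star_ge_1:
  assumes lim: "(\<lambda>p. M p (Suc p)) \<longlonglongrightarrow> 1 / 2"
  shows "\<rho>\<^sub>s \<ge> 1"
proof (rule ccontr)
  assume "\<not> \<rho>\<^sub>s \<ge> 1"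
  then obtain s where s: "\<rho>\<^sub>s < s" "s < 1" "s > 0" using dense[of "\<rho>\<^sub>s" 1] rho_star_pos by force
  define w where "w = green s"
  have w: "w p > 0" if "p \<ge> k" for p
    unfolding w_def using s that by (intro green_pos green_finite_above)
  have mv_w: "mv w p \<le> s * w p" if "p \<ge> k" for p
    unfolding w_def using s that by (subst mv_green) (auto intro: green_finite_above)
  obtain a where a: "s / 2 < a" "a < 1 / 2" using dense[of "s / 2" "1 / 2"] s by auto
  then obtain K0 where K0: "\<And>p. p \<ge> K0 \<Longrightarrow> M p (Suc p) > a"
    using order_tendstoD(1)[OF lim] by (auto simp: eventually_sequentially)
  define K where "K = max K0 k"
  \<comment> \<open>Riccati argument: beyond \<open>K\<close> the ratios satisfy
    \<open>1 / t p + t (Suc p) \<le> s / a\<close>. Since \<open>x + 1 / x \<ge> 2\<close> and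
    \<open>s / a < 2\<close>, they drop by at least \<open>d\<close> at every step and finally
    become negative.\<close>
  define t where "t p = w (Suc p) / w p" for p
  define d where "d = 2 - s / a"
  have d: "d > 0" unfolding d_def using a s by (simp add: field_simps)
  have t_pos: "t p > 0" if "p \<ge> k" for p unfolding t_def using w that by simp
  have t_dec: "t (Suc p) \<le> t p - d" if p: "p \<ge> K" for p
  proof -
    have pk: "p \<ge> k" "p \<ge> K0" using p by (auto simp: K_def)
    have "a * w p + a * w (Suc (Suc p)) \<le> M (Suc p) p * w p + M (Suc p) (Suc (Suc p)) * w (Suc (Suc p))"
      using K0[of p] K0[of "Suc p"] w[of p] w[of "Suc (Suc p)"] pk sym[of "Suc p" p]
      by (intro add_mono mult_right_mono) (auto simp: less_imp_le)
    also have "\<dots> \<le> s * w (Suc p)" using mv_w[of "Suc p"] pk by (simp add: mv_Suc)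
    finally have "(a * w p + a * w (Suc (Suc p))) / (a * w (Suc p)) \<le> s * w (Suc p) / (a * w (Suc p))"
      using w[of "Suc p"] pk a s by (intro divide_right_mono) auto
    moreover have "(a * w p + a * w (Suc (Suc p))) / (a * w (Suc p)) = 1 / t p + t (Suc p)"
      using w[of "Suc p"] w[of p] pk a s by (simp add: t_def field_simps)
    moreover have "s * w (Suc p) / (a * w (Suc p)) = s / a"
      using w[of "Suc p"] pk by simp
    moreover have "2 - t p \<le> 1 / t p"
    proof -
      have "0 \<le> (t p - 1)\<^sup>2" by simp
      then show ?thesis using t_pos[OF pk(1)] by (simp add: field_simps power2_eq_square)
    qed
    ultimately show ?thesis by (simp add: d_def)
  qed
  have t_le: "t (K + n) \<le> t K - real n * d" for n
  proof (induction n)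
    case (Suc n)
    then show ?case using t_dec[of "K + n"] by (simp add: algebra_simps)
  qed simp
  obtain n where "t K < real n * d" using reals_Archimedean3[OF d] by blast
  moreover have "k \<le> K + n" by (simp add: K_def trans_le_add1)
  ultimately show False using t_le[of n] t_pos[of "K + n"] by simp
qed

text \<open>Each application of \<open>1 + M\<close> spreads the strictness of a supersolution to one more index.\<close>

lemma strict_supersolution:
  assumes s: "s > 0" and w: "\<And>p. p \<ge> k \<Longrightarrow> w p > 0" and le: "\<And>p. p \<ge> k \<Longrightarrow> mv w p \<le> s * w p"
    and strict: "mv w k < s * w k"
  shows "\<exists>v. (\<forall>p\<ge>k. v p > 0 \<and> mv v p \<le> s * v p) \<and> (\<forall>p\<in>{k..k+m}. mv v p < s * v p)"
proof (induction m)
  case 0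
  then show ?case using assms by (intro exI[of _ w]) auto
next
  case (Suc m)
  then obtain v where v: "\<And>p. p \<ge> k \<Longrightarrow> v p > 0" "\<And>p. p \<ge> k \<Longrightarrow> mv v p \<le> s * v p"
    "\<And>p. p \<ge> k \<Longrightarrow> p \<le> k + m \<Longrightarrow> mv v p < s * v p"
    unfolding Ball_def atLeastAtMost_iff by blast
  define u where "u p = v p + mv v p" for p
  have u: "s * u p - mv u p = (s * v p - mv v p) + mv (\<lambda>q. s * v q - mv v q) p" for p
    unfolding u_def mv_diff mv_add mv_scale by (simp add: algebra_simps)
  have nonneg: "mv (\<lambda>q. s * v q - mv v q) p \<ge> 0" for p
    using v(2) by (intro mv_nonneg) auto
  have "u p > 0" if "p \<ge> k" for p
    unfolding u_def using v(1) that by (intro add_pos_nonneg mv_nonneg) (auto simp: less_imp_le)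
  moreover have "mv u p \<le> s * u p" if "p \<ge> k" for p
    using u[of p] v(2)[OF that] nonneg[of p] by linarith
  moreover have "mv u p < s * u p" if p: "p \<ge> k" "p \<le> k + Suc m" for p
  proof (cases "p = k + Suc m")
    case True
    have "mv (\<lambda>q. s * v q - mv v q) p > 0"
      using v(2,3) True by (intro mv_pos[of _ p "k + m"]) auto
    then show ?thesis using u[of p] v(2)[OF p(1)] by linarith
  next
    case False
    then show ?thesis using u[of p] v(3)[OF p(1)] nonneg[of p] p(2) by simp
  qed
  ultimately show ?case by (intro exI[of _ u]) auto
qed

text \<open>
  If \<open>\<rho>\<^sub>s > 1\<close> and the Green function were finite at \<open>\<rho>\<^sub>s\<close>, a supersolution \<open>v\<close> at \<open>\<rho>\<^sub>s\<close> that is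
  strict on a long initial segment could be combined with the constants, which are strict
  supersolutions near infinity: \<open>min v C + c\<close> is a supersolution strictly below \<open>\<rho>\<^sub>s\<close>.
\<close>

lemma rho_star_le_1:
  assumes lim: "(\<lambda>p. M p (Suc p)) \<longlonglongrightarrow> 1 / 2" and fin: "green_finite \<rho>\<^sub>s"
  shows "\<rho>\<^sub>s \<le> 1"
proof (rule ccontr)
  assume "\<not> \<rho>\<^sub>s \<le> 1"
  define s where "s = \<rho>\<^sub>s"
  have s: "s > 1" using \<open>\<not> \<rho>\<^sub>s \<le> 1\<close> by (simp add: s_def)
  then obtain q where q: "1 < q" "q < s" using dense by blast
  obtain K where K: "\<And>p. p \<ge> K \<Longrightarrow> M p (Suc p) < q / 2"
    using order_tendstoD(2)[OF lim, of "q / 2"] q by (auto simp: eventually_sequentially)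
  \<comment> \<open>Each entry of such a row is below \<open>q / 2\<close>. The inequality
    \<open>p > K\<close> is strict because row \<open>p\<close> also contains the entry between
    \<open>p - 1\<close> and \<open>p\<close>.\<close>
  have tail: "mv (\<lambda>_. 1) p \<le> q" if p: "p \<ge> k" "p > K" for p
  proof (cases "p = k")
    case True
    then show ?thesis using K[of k] p q by (simp add: mv_bot)
  next
    case False
    then obtain p' where p': "p = Suc p'" "p' \<ge> k" "p' \<ge> K" using p by (cases p) auto
    then show ?thesis using K[of p'] K[of p] sym[of p p'] by (simp add: mv_Suc)
  qed
  \<comment> \<open>The source term makes the Green function strict at \<open>k\<close>.\<close>
  have "mv (green s) k < s * green s k" "\<And>p. p \<ge> k \<Longrightarrow> mv (green s) p \<le> s * green s p"
    "\<And>p. p \<ge> k \<Longrightarrow> green s p > 0"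
    using mv_green[of s] green_pos[of s] fin s by (auto simp: s_def)
  from strict_supersolution[OF _ this(3,2,1), of K] s
  have "\<exists>v. (\<forall>p\<ge>k. v p > 0 \<and> mv v p \<le> s * v p) \<and> (\<forall>p\<in>{k..k+K}. mv v p < s * v p)" by simp
  then obtain v where v: "\<And>p. p \<ge> k \<Longrightarrow> v p > 0" "\<And>p. p \<ge> k \<Longrightarrow> mv v p \<le> s * v p"
    "\<And>p. p \<ge> k \<Longrightarrow> p \<le> k + K \<Longrightarrow> mv v p < s * v p"
    unfolding Ball_def atLeastAtMost_iff by blast
  define C where "C = Max (v ` {k..k+K})"
  define g where "g = Min ((\<lambda>p. s * v p - mv v p) ` {k..k+K})"
  have C: "v p \<le> C" if "p \<ge> k" "p \<le> k + K" for p
    unfolding C_def using that by (intro Max_ge) auto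
  have C_pos: "C > 0" using C[of k] v(1)[of k] by simp
  have g: "g \<le> s * v p - mv v p" if "p \<ge> k" "p \<le> k + K" for p
    unfolding g_def using that by (intro Min_le) auto
  have g_pos: "g > 0" unfolding g_def using v(3) by (subst Min_gr_iff) auto
  \<comment> \<open>Adding the constant \<open>c\<close> then costs at most half of the slack
    \<open>g\<close> on the initial segment.\<close>
  define c where "c = g / (4 * B)"
  have c: "c > 0" "2 * B * c = g / 2" unfolding c_def using g_pos B_pos by auto
  \<comment> \<open>\<open>u\<close> is at most \<open>C + c\<close>, so lowering the rate by
    \<open>e\<close> costs at most \<open>e * (C + c)\<close>. This must fit both the remaining
    slack \<open>g / 2\<close> and the slack \<open>c * (s - q)\<close> of the constant in the
    tail.\<close>
  define e where "e = min (g / 2) (c * (s - q)) / (C + c)"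
  have e: "e > 0" unfolding e_def using g_pos c q C_pos by simp
  have eC: "e * (C + c) \<le> g / 2" "e * (C + c) \<le> c * (s - q)"
    unfolding e_def using C_pos c by auto
  define u where "u p = min (v p) C + c" for p
  have mv_u: "mv u p = mv (\<lambda>p. min (v p) C) p + mv (\<lambda>_. c) p" for p
    unfolding u_def by (rule mv_add)
  have "mv u p \<le> (s - e) * u p" if p: "p \<ge> k" for p
  proof (cases "p \<le> k + K")
    case True
    \<comment> \<open>The truncation level \<open>C\<close> is the maximum of \<open>v\<close> here,
      so truncation is inactive on this segment.\<close>
    then have min: "min (v p) C = v p" using C p by (simp add: min_absorb1)
    have "mv u p \<le> mv v p + 2 * B * c"
      unfolding mv_u using p c by (intro add_mono mv_mono mv_const) auto
    also have "\<dots> \<le> s * v p - g / 2" using g[OF p True] c by simp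
    also have "\<dots> \<le> s * v p - e * (C + c)" using eC by simp
    also have "\<dots> \<le> s * v p - e * (v p + c)" using C[OF p True] e by simp
    also have "\<dots> \<le> (s - e) * u p" unfolding u_def min using c s by (simp add: algebra_simps)
    finally show ?thesis .
  next
    case False
    then have one: "mv (\<lambda>_. 1) p \<le> q" using p tail[of p] by simp
    have const: "mv (\<lambda>_. x) p \<le> x * q" if "x \<ge> 0" for x
      using mv_scale[of x "\<lambda>_. 1" p] mult_left_mono[OF one that] by simp
    \<comment> \<open>In the tail both \<open>v\<close> and the constant \<open>C\<close> are
      supersolutions at \<open>s\<close>, hence so is their minimum.\<close>
    have "mv (\<lambda>p. min (v p) C) p \<le> mv v p" "mv (\<lambda>p. min (v p) C) p \<le> mv (\<lambda>_. C) p"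
      by (auto intro: mv_mono)
    moreover have "C * q \<le> s * C" using q C_pos by simp
    ultimately have "mv (\<lambda>p. min (v p) C) p \<le> s * v p" "mv (\<lambda>p. min (v p) C) p \<le> s * C"
      using v(2)[OF p] const[of C] C_pos by linarith+
    then have "mv (\<lambda>p. min (v p) C) p \<le> s * min (v p) C" by (cases "v p \<le> C") (simp_all add: min_absorb1 min_absorb2)
    moreover have "mv (\<lambda>_. c) p \<le> c * q" using const c by simp
    moreover have "e * min (v p) C \<le> e * C" using e by simp
    ultimately show ?thesis
      unfolding mv_u using eC(2) by (simp add: u_def algebra_simps)
  qed
  moreover have "u p > 0" if "p \<ge> k" for p
    using v(1)[OF that] C_pos c by (simp add: u_def add_pos_pos)
  ultimately have "\<rho>\<^sub>s \<le> s - e" by (intro rho_star_le)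
  then show False using e by (simp add: s_def)
qed

end

section \<open>The matrices \<open>Q\<close> and \<open>R\<close>\<close>

locale sos_model =
  fixes b :: "nat \<Rightarrow> real"
  assumes b_pos: "b n > 0" and b_lim: "b \<longlonglongrightarrow> 1"
begin

lemma Q_lim: "(\<lambda>p. Q b p (Suc p)) \<longlonglongrightarrow> 1 / 2"
proof -
  have "(\<lambda>p. 1 / (2 * sqrt (b p * b (Suc p)))) \<longlonglongrightarrow> 1 / (2 * sqrt (1 * 1))"
    by (intro tendsto_intros b_lim LIMSEQ_Suc) auto
  then show ?thesis by (simp add: Q_def)
qed

lemma jacobi_Q: "jacobi (Q b)"
proof
  show "bdd_above (range (\<lambda>p. Q b p (Suc p)))"
    using convergent_imp_Bseq[OF convergentI[OF Q_lim]] by (auto simp: Bseq_eq_bounded bounded_imp_bdd_above)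
qed (use b_pos in \<open>auto simp: Q_def mult.commute\<close>)

sublocale R: jacobi "Q b" 1
  by (rule jacobi_Q)

sublocale Z: jacobi "Q b" 0
  by (rule jacobi_Q)

abbreviation "\<rho>\<^sub>R \<equiv> rho_star {1..} (Q b)"
abbreviation "\<rho>\<^sub>Q \<equiv> rho_star {0..} (Q b)"

text \<open>Real form of the ratio defining the critical value; it agrees with the extended-real
  ratio only where the Green function is finite.\<close>

definition F :: "real \<Rightarrow> real" where
  "F \<rho> = R.green \<rho> 1 / (4 * b 1 * \<rho>)"

text \<open>Row 2 carries no source, so \<open>R w\<close> would be positive there while
  \<open>\<rho> * w 2\<close> is not. This keeps nonpositive \<rho> out of the uniqueness
  claim.\<close>

lemma w1_nonpos:
  assumes "\<rho> \<le> 0"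
  shows "w1 b \<rho> = \<infinity>"
proof -
  have False if w: "\<forall>p\<ge>1. w p > 0" "\<forall>p\<ge>1. R.mv w p = \<rho> * w p - (if p = 1 then 1 else 0)" for w :: "nat \<Rightarrow> real"
  proof -
    have "R.mv w 2 > 0" using w(1) by (intro R.mv_pos[of _ 2 3]) (auto simp: less_imp_le)
    moreover have "\<rho> * w 2 \<le> 0" using assms w(1) by (auto simp: mult_le_0_iff less_imp_le)
    ultimately show False using w(2) by simp
  qed
  then have "{ereal (w 1) | w. (\<forall>p\<ge>1. w p > 0) \<and> (\<forall>p\<ge>1. R.mv w p = \<rho> * w p - (if p = 1 then 1 else 0))} = {}"
    by blast
  then show ?thesis unfolding w1_def by (simp only: Inf_empty top_ereal_def)
qed

text \<open>The Green function is itself an admissible solution and, by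
  \<open>green_minimal\<close>, the smallest; any admissible solution forces it to be
  finite.\<close>

lemma w1_eq:
  assumes "\<rho> > 0"
  shows "w1 b \<rho> = (if R.green_finite \<rho> then ereal (R.green \<rho> 1) else \<infinity>)"
proof -
  define S where "S = {w :: nat \<Rightarrow> real. (\<forall>p\<ge>1. w p > 0) \<and>
    (\<forall>p\<ge>1. R.mv w p = \<rho> * w p - (if p = 1 then 1 else 0))}"
  have w1: "w1 b \<rho> = (INF w\<in>S. ereal (w 1))"
    unfolding w1_def S_def by (intro arg_cong[of _ _ Inf]) auto
  have le: "R.green_finite \<rho> \<and> R.green \<rho> 1 \<le> w 1" if "w \<in> S" for w
    using that R.green_minimal[of \<rho> w] assms unfolding S_def by (simp add: less_imp_le)
  show ?thesis
  proof (cases "R.green_finite \<rho>")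
    case True
    then have "R.green \<rho> \<in> S"
      unfolding S_def using R.green_pos[OF assms] R.mv_green[OF assms] by auto
    then have "w1 b \<rho> = ereal (R.green \<rho> 1)"
      unfolding w1 using le by (intro antisym INF_lower INF_greatest) auto
    then show ?thesis using True by simp
  next
    case False
    then have "S = {}" using le by blast
    then show ?thesis unfolding w1 using False by (simp add: top_ereal_def)
  qed
qed

lemma w1_ratio:
  assumes "\<rho> > 0"
  shows "w1 b \<rho> / ereal (4 * b 1 * \<rho>) = (if R.green_finite \<rho> then ereal (F \<rho>) else \<infinity>)"
  using assms b_pos[of 1] by (simp add: w1_eq F_def)

lemma F_antimono:
  assumes "0 < s" "s < t" "R.green_finite s"
  shows "F t < F s"
  unfolding F_def
proof (rule frac_less2)
  show "0 < R.green t 1" using assms R.green_finite_mono(1)[of s t] by (intro R.green_pos) auto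
  show "R.green t 1 \<le> R.green s 1" using assms by (intro R.green_finite_mono(2)) auto
qed (use assms b_pos[of 1] in auto)

lemma isCont_F:
  assumes "\<rho>\<^sub>R < s"
  shows "isCont F s"
  unfolding F_def using R.isCont_green[OF assms] assms R.rho_star_pos b_pos[of 1]
  by (intro continuous_intros) auto

lemma Q01_square: "Q b 0 1 ^ 2 = 1 / (4 * b 0 * b 1)"
  using b_pos[of 0] b_pos[of 1] by (simp add: Q_def power_divide power_mult_distrib)

text \<open>
  At index \<open>0\<close> the eigenvalue equation for \<open>Q\<close> reads \<open>Q\<^sub>0\<^sub>1\<^sup>2 w\<^sub>1 = \<rho>\<close>, i.e. \<open>w\<^sub>1 / (4 \<rho> b\<^sub>1) = b\<^sub>0\<close>.
\<close>

lemma rho_Q_le: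
  assumes \<rho>: "\<rho> > 0" and fin: "R.green_finite \<rho>" and le: "F \<rho> \<le> b 0"
  shows "\<rho>\<^sub>Q \<le> \<rho>"
proof (rule Z.rho_star_le)
  define a where "a = Q b 0 1"
  define g where "g = R.green \<rho>"
  \<comment> \<open>The value 1 at index 0 contributes \<open>a\<close> to row 1, exactly the source
    that \<open>a * g\<close> lacks there. All rows above 0 become equalities, and row 0 is where
    \<open>F \<rho> \<le> b 0\<close> enters.\<close>
  define h where "h p = (if p = 0 then 1 else a * g p)" for p
  have a: "a > 0" unfolding a_def using Z.pos[of 0] by simp
  note g = R.green_pos[OF \<rho> fin, folded g_def] R.mv_green[OF \<rho> fin, folded g_def]
  show "h p > 0" for p unfolding h_def using a g by simp
  show "Z.mv h p \<le> \<rho> * h p" for p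
  proof (cases p)
    case 0
    have "a * (a * g 1) = F \<rho> * \<rho> / b 0"
      using Q01_square b_pos[of 0] b_pos[of 1] \<rho>
      by (simp add: a_def g_def F_def power2_eq_square flip: mult.assoc)
    also have "\<dots> \<le> b 0 * \<rho> / b 0"
      using le \<rho> b_pos[of 0] by (intro divide_right_mono mult_right_mono) auto
    finally show ?thesis using b_pos[of 0] 0 Z.mv_bot[of h] by (simp add: h_def a_def)
  next
    case (Suc p')
    have "Z.mv h p = a * R.mv g p + (if p = 1 then a else 0)"
    proof (cases p')
      case 0
      then show ?thesis
        using Suc Z.mv_Suc[of 0 h] R.mv_bot[of g] Z.sym[of 1 0] by (simp add: h_def a_def)
    next
      case (Suc p'')
      then show ?thesis
        using \<open>p = Suc p'\<close> Z.mv_Suc[of p' h] R.mv_Suc[of p' g] by (simp add: h_def algebra_simps)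
    qed
    also have "\<dots> = a * (R.mv g p + (if p = 1 then 1 else 0))" by (simp add: algebra_simps)
    also have "\<dots> = a * (\<rho> * g p)" using g(2)[of p] Suc by simp
    also have "\<dots> = \<rho> * h p" using Suc by (simp add: h_def)
    finally show ?thesis by simp
  qed
qed

text \<open>Converse of \<open>rho_Q_le\<close>: the Green function of \<open>Q\<close> without its
  entry at 0, divided by \<open>a * u 0\<close>, solves the equation for \<open>R\<close> with unit
  source and so dominates the Green function of \<open>R\<close>.\<close>

lemma F_less:
  assumes "\<rho>\<^sub>Q < \<rho>"
  shows "R.green_finite \<rho>" "F \<rho> < b 0"
proof -
  define a where "a = Q b 0 1"
  define u where "u = Z.green \<rho>"
  define w where "w p = u p / (a * u 0)" for p
  have a: "a > 0" unfolding a_def using Z.pos[of 0] by simp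
  have \<rho>: "\<rho> > 0" using assms Z.rho_star_pos by linarith
  note u = Z.green_pos[OF \<rho> Z.green_finite_above[OF assms], folded u_def]
    Z.mv_green[OF \<rho> Z.green_finite_above[OF assms], folded u_def]
  have w: "w p > 0" for p unfolding w_def using u a by simp
  have w_eq: "R.mv w p = \<rho> * w p - (if p = 1 then 1 else 0)" if p: "p \<ge> 1" for p
  proof (cases "p = 1")
    case True
    have "R.mv w 1 = (Z.mv u 1 - a * u 0) / (a * u 0)"
      unfolding R.mv_bot w_def using Z.mv_Suc[of 0 u] Z.sym[of 1 0] by (simp add: a_def)
    also have "\<dots> = \<rho> * w 1 - 1"
      unfolding w_def using u(1)[of 0] u(2)[of 1] a by (simp add: field_simps)
    finally show ?thesis using True by simp
  next
    case False
    then obtain p' where p': "p = Suc p'" "p' \<ge> 1" using p by (cases p) auto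
    have "R.mv w p = Z.mv u p / (a * u 0)"
      unfolding w_def using p' R.mv_Suc[of p'] Z.mv_Suc[of p' u] by (simp add: add_divide_distrib)
    then show ?thesis using u(2)[of p] False p by (simp add: w_def)
  qed
  have min: "R.green_finite \<rho>" "R.green \<rho> 1 \<le> w 1"
    using R.green_minimal[OF \<rho>, of w] w w_eq by (auto simp: less_imp_le)
  show "R.green_finite \<rho>" by (rule min)
  \<comment> \<open>The source in row 0 makes the final inequality strict.\<close>
  have "a * u 1 = \<rho> * u 0 - 1" using u(2)[of 0] Z.mv_bot[of u] by (simp add: a_def)
  then have "a ^ 2 * w 1 = (\<rho> * u 0 - 1) / u 0"
    unfolding w_def using a by (simp add: power2_eq_square)
  also have "\<dots> < \<rho>" using u(1)[of 0] by (simp add: field_simps)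
  finally have "a ^ 2 * R.green \<rho> 1 < \<rho>" using min(2) a
    by (smt (verit) mult_left_mono zero_le_power2)
  then have "R.green \<rho> 1 < \<rho> * (4 * b 0 * b 1)"
    unfolding a_def Q01_square using b_pos[of 0] b_pos[of 1] by (simp add: field_simps)
  then show "F \<rho> < b 0"
    unfolding F_def using b_pos[of 1] \<rho> by (simp add: field_simps)
qed

section \<open>The critical value and the two regimes\<close>

lemma b0c_eq: "b0c b = (SUP \<rho>\<in>{\<rho>\<^sub>R<..}. ereal (F \<rho>))"
proof -
  define f where "f \<rho> = w1 b \<rho> / ereal (4 * b 1 * \<rho>)" for \<rho>
  define L where "L = (SUP \<rho>\<in>{\<rho>\<^sub>R<..}. ereal (F \<rho>))"
  have f: "f \<rho> = ereal (F \<rho>)" if "\<rho> > \<rho>\<^sub>R" for \<rho>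
    unfolding f_def using that R.rho_star_pos R.green_finite_above by (subst w1_ratio) auto
  have "(f \<longlongrightarrow> L) (at_right \<rho>\<^sub>R)"
  proof (rule order_tendstoI)
    fix c assume "c < L"
    then obtain \<rho> where \<rho>: "\<rho> > \<rho>\<^sub>R" "c < ereal (F \<rho>)" unfolding L_def by (auto simp: less_SUP_iff)
    \<comment> \<open>\<open>F\<close> is decreasing, so a value exceeding \<open>c\<close> at
      \<open>\<rho>\<close> persists for all \<open>t\<close> closer to
      \<open>\<rho>\<^sub>R\<close>.\<close>
    have "c < f t" if "\<rho>\<^sub>R < t" "t < \<rho>" for t
      using F_antimono[of t \<rho>] that R.rho_star_pos R.green_finite_above[OF that(1)] \<rho> f[OF that(1)]
      by (auto intro: order.strict_trans)
    then show "eventually (\<lambda>t. c < f t) (at_right \<rho>\<^sub>R)"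
      using \<rho>(1) by (auto simp: eventually_at_right_field)
  next
    fix c assume c: "L < c"
    have "f t < c" if "\<rho>\<^sub>R < t" for t
      using that c f[OF that] SUP_upper[of t "{\<rho>\<^sub>R<..}" "\<lambda>\<rho>. ereal (F \<rho>)"] unfolding L_def
      by (auto intro: order.strict_trans1)
    then show "eventually (\<lambda>t. f t < c) (at_right \<rho>\<^sub>R)"
      using eventually_at_right_less[of "\<rho>\<^sub>R"] by (auto elim: eventually_mono)
  qed
  then have "Lim (at_right \<rho>\<^sub>R) f = L" by (intro tendsto_Lim) auto
  then show ?thesis unfolding b0c_def f_def L_def .
qed

lemma subcritical:
  assumes "ereal (b 0) < b0c b"
  shows "\<rho>\<^sub>Q > 1" "R.green_finite \<rho>\<^sub>Q" "F \<rho>\<^sub>Q = b 0"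
proof -
  obtain \<rho> where \<rho>: "\<rho> > \<rho>\<^sub>R" "b 0 < F \<rho>"
    using assms unfolding b0c_eq by (auto simp: less_SUP_iff)
  \<comment> \<open>Above \<open>\<rho>\<^sub>Q\<close> the function \<open>F\<close> is below
    \<open>b 0\<close>. This puts \<open>\<rho>\<^sub>Q\<close> in the region where \<open>F\<close>
    is continuous, and one-sided limits give the crossing.\<close>
  then have "\<rho> \<le> \<rho>\<^sub>Q" using F_less(2)[of \<rho>] by force
  with \<rho> have less: "\<rho>\<^sub>R < \<rho>\<^sub>Q" by simp
  then show "\<rho>\<^sub>Q > 1" using R.rho_star_ge_1[OF Q_lim] by simp
  show "R.green_finite \<rho>\<^sub>Q" by (rule R.green_finite_above[OF less])
  have lim: "F \<midarrow>\<rho>\<^sub>Q\<rightarrow> F \<rho>\<^sub>Q" using isCont_F[OF less] by (simp add: isCont_def)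
  have "F \<rho>\<^sub>Q \<le> b 0"
  proof (rule tendsto_upperbound)
    show "(F \<longlongrightarrow> F \<rho>\<^sub>Q) (at_right \<rho>\<^sub>Q)" using lim by (rule filterlim_mono) (auto intro: at_le)
    show "eventually (\<lambda>t. F t \<le> b 0) (at_right \<rho>\<^sub>Q)"
      using eventually_at_right_less[of "\<rho>\<^sub>Q"] F_less(2) by (auto elim!: eventually_mono intro: less_imp_le)
  qed simp
  moreover have "b 0 \<le> F \<rho>\<^sub>Q"
  proof (rule tendsto_lowerbound)
    show "(F \<longlongrightarrow> F \<rho>\<^sub>Q) (at_left \<rho>\<^sub>Q)" using lim by (rule filterlim_mono) (auto intro: at_le)
    \<comment> \<open>Otherwise \<open>rho_Q_le\<close> would give
      \<open>\<rho>\<^sub>Q \<le> t\<close>.\<close>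
    have "b 0 \<le> F t" if "\<rho>\<^sub>R < t" "t < \<rho>\<^sub>Q" for t
      using rho_Q_le[OF _ R.green_finite_above[OF that(1)]] that R.rho_star_pos by fastforce
    then show "eventually (\<lambda>t. b 0 \<le> F t) (at_left \<rho>\<^sub>Q)"
      using less by (auto simp: eventually_at_left_field)
  qed simp
  ultimately show "F \<rho>\<^sub>Q = b 0" by simp
qed

lemma supercritical:
  assumes "b0c b < ereal (b 0)"
  shows "\<rho>\<^sub>Q = 1"
proof (rule antisym)
  have F_le: "F t \<le> b 0" if "\<rho>\<^sub>R < t" for t
    using that assms SUP_upper[of t "{\<rho>\<^sub>R<..}" "\<lambda>\<rho>. ereal (F \<rho>)"] unfolding b0c_eq
    by (auto dest: order.strict_trans1)
  have "\<rho>\<^sub>Q \<le> t" if "\<rho>\<^sub>R < t" for t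
    using rho_Q_le[OF _ R.green_finite_above[OF that] F_le[OF that]] that R.rho_star_pos by simp
  then have "\<rho>\<^sub>Q \<le> \<rho>\<^sub>R" by (rule dense_ge)
  also have "\<rho>\<^sub>R \<le> 1"
  proof (rule R.rho_star_le_1[OF Q_lim])
    show "R.green_finite \<rho>\<^sub>R"
      unfolding R.green_finite_def
    proof (rule summableI_nonneg_bounded)
      fix m
      \<comment> \<open>This is \<open>F t \<le> b 0\<close> cleared of denominators; for a finite
        partial sum \<open>t\<close> may tend to \<open>\<rho>\<^sub>R\<close> from the
        right.\<close>
      show "(\<Sum>n<m. R.mp n 1 1 / \<rho>\<^sub>R ^ Suc n) \<le> b 0 * (4 * b 1 * \<rho>\<^sub>R)"
      proof (rule tendsto_le)
        show "((\<lambda>t. \<Sum>n<m. R.mp n 1 1 / t ^ Suc n) \<longlongrightarrow> (\<Sum>n<m. R.mp n 1 1 / \<rho>\<^sub>R ^ Suc n)) (at_right \<rho>\<^sub>R)"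
          using R.rho_star_pos by (intro tendsto_intros) auto
        show "((\<lambda>t. b 0 * (4 * b 1 * t)) \<longlongrightarrow> b 0 * (4 * b 1 * \<rho>\<^sub>R)) (at_right \<rho>\<^sub>R)"
          by (intro tendsto_intros)
        have "(\<Sum>n<m. R.mp n 1 1 / t ^ Suc n) \<le> b 0 * (4 * b 1 * t)" if t: "\<rho>\<^sub>R < t" for t
        proof -
          have pos: "t > 0" using t R.rho_star_pos by linarith
          have "(\<Sum>n<m. R.mp n 1 1 / t ^ Suc n) \<le> R.green t 1"
            using R.green_finite_above[OF t] pos R.mp_nonneg unfolding R.green_def R.green_finite_def
            by (intro sum_le_suminf) auto
          also have "\<dots> = F t * (4 * b 1 * t)" unfolding F_def using pos b_pos[of 1] by simp
          also have "\<dots> \<le> b 0 * (4 * b 1 * t)"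
            using F_le[OF t] pos b_pos[of 1] by (intro mult_right_mono) auto
          finally show ?thesis .
        qed
        then show "eventually (\<lambda>t. (\<Sum>n<m. R.mp n 1 1 / t ^ Suc n) \<le> b 0 * (4 * b 1 * t)) (at_right \<rho>\<^sub>R)"
          using eventually_at_right_less[of "\<rho>\<^sub>R"] by (auto elim!: eventually_mono)
      qed simp
    qed (use R.rho_star_pos R.mp_nonneg in auto)
  qed
  finally show "\<rho>\<^sub>Q \<le> 1" .
  show "1 \<le> \<rho>\<^sub>Q" by (rule Z.rho_star_ge_1[OF Q_lim])
qed

section \<open>Partition functions\<close>

text \<open>\<open>Q\<close> splits the weight \<open>1 / b x\<close> of a site evenly between its
  two adjacent steps. The two ends of the path lose a square root each, which is the
  prefactor.\<close>

lemma path_sum: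
  "(\<Sum>X | X \<in> sos_paths N \<and> X N = j. (1/2) ^ N * (\<Prod>n=0..N. inverse (b (X n)))) =
    Z.mp N 0 j / sqrt (b 0 * b j)"
proof (induction N arbitrary: j)
  case 0
  have "{X. X \<in> sos_paths 0 \<and> X 0 = j} = (if j = 0 then {\<lambda>n. if n = 0 then 0 else undefined} else {})"
    by (auto simp: sos_paths_def PiE_iff extensional_def)
  then show ?case using b_pos[of 0] by (simp add: inverse_eq_divide)
next
  case (Suc N)
  define W where "W X = (1/2) ^ N * (\<Prod>n=0..N. inverse (b (X n)))" for X :: "nat \<Rightarrow> nat"
  define adj where "adj l \<longleftrightarrow> \<bar>int j - int l\<bar> = 1" for l :: nat
  define S where "S = {Y \<in> sos_paths N. adj (Y N)}"
  have fin: "finite S" unfolding S_def using finite_sos_paths by simp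
  have "(\<Sum>X | X \<in> sos_paths (Suc N) \<and> X (Suc N) = j. (1/2) ^ Suc N * (\<Prod>n=0..Suc N. inverse (b (X n)))) =
      (\<Sum>Y\<in>S. W Y * (1 / (2 * b j)))"
  \<comment> \<open>Deleting the last site is a bijection onto paths of length \<open>N\<close>
    ending next to \<open>j\<close>.\<close>
  proof (rule sum.reindex_bij_witness[where i = "\<lambda>Y. Y(Suc N := j)" and j = "\<lambda>X. restrict X {0..N}"])
    fix X assume X: "X \<in> {X. X \<in> sos_paths (Suc N) \<and> X (Suc N) = j}"
    show "(restrict X {0..N})(Suc N := j) = X"
    proof
      fix n
      show "((restrict X {0..N})(Suc N := j)) n = X n"
        using X by (cases "n \<le> Suc N") (auto simp: sos_paths_def PiE_iff extensional_def le_Suc_eq)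
    qed
    show "restrict X {0..N} \<in> S"
      using X by (auto simp: S_def adj_def sos_paths_def PiE_iff)
    have "(\<Prod>n=0..N. inverse (b (restrict X {0..N} n))) = (\<Prod>n=0..N. inverse (b (X n)))"
      by (intro prod.cong) auto
    then show "W (restrict X {0..N}) * (1 / (2 * b j)) = (1/2) ^ Suc N * (\<Prod>n=0..Suc N. inverse (b (X n)))"
      using X by (simp add: W_def field_simps)
  next
    fix Y assume Y: "Y \<in> S"
    show "restrict (Y(Suc N := j)) {0..N} = Y"
      using Y by (auto simp: S_def sos_paths_def PiE_iff extensional_def fun_eq_iff)
    show "Y(Suc N := j) \<in> {X. X \<in> sos_paths (Suc N) \<and> X (Suc N) = j}"
      using Y by (auto simp: S_def adj_def sos_paths_def PiE_iff extensional_def less_Suc_eq)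
  qed
  \<comment> \<open>Group by the last height \<open>l\<close> of \<open>Y\<close>; a neighbour of
    \<open>j\<close> is at most \<open>Suc j\<close>.\<close>
  also have "\<dots> = (\<Sum>l=0..Suc j. \<Sum>Y | Y \<in> S \<and> Y N = l. W Y * (1 / (2 * b j)))"
    by (rule sum.group[symmetric]) (use fin in \<open>auto simp: S_def adj_def\<close>)
  also have "\<dots> = (\<Sum>l=0..Suc j. Z.mp N 0 l * Q b l j / sqrt (b 0 * b j))"
  proof (intro sum.cong refl)
    fix l
    show "(\<Sum>Y | Y \<in> S \<and> Y N = l. W Y * (1 / (2 * b j))) = Z.mp N 0 l * Q b l j / sqrt (b 0 * b j)"
    proof (cases "adj l")
      case True
      then have "{Y. Y \<in> S \<and> Y N = l} = {Y. Y \<in> sos_paths N \<and> Y N = l}" by (auto simp: S_def)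
      then have "(\<Sum>Y | Y \<in> S \<and> Y N = l. W Y * (1 / (2 * b j))) = Z.mp N 0 l / sqrt (b 0 * b l) * (1 / (2 * b j))"
        using Suc[of l] by (simp add: W_def flip: sum_divide_distrib sum_distrib_right)
      moreover have "Q b l j = 1 / (2 * sqrt (b l * b j))" using True by (simp add: Q_def adj_def abs_minus_commute)
      ultimately show ?thesis using b_pos[of j] by (simp add: real_sqrt_mult)
    next
      case False
      then have "{Y. Y \<in> S \<and> Y N = l} = {}" "Q b l j = 0" by (auto simp: S_def Q_def adj_def)
      then show ?thesis by (simp only: sum.empty mult_zero_right div_0)
    qed
  qed
  also have "\<dots> = Z.mp (Suc N) 0 j / sqrt (b 0 * b j)"
    by (simp only: Z.mp_Suc_right le0 sum_divide_distrib)
  finally show ?case .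
qed

lemma Z_bridge_eq: "Z_bridge b N = Z.mp (2 * N) 0 0 / b 0"
  unfolding Z_bridge_def path_sum using b_pos[of 0] by simp

lemma sos_path_le: "X \<in> sos_paths N \<Longrightarrow> i \<le> N \<Longrightarrow> X i \<le> i"
proof (induction i)
  case 0
  then show ?case by (simp add: sos_paths_def)
next
  case (Suc i)
  then have "\<bar>int (X (Suc i)) - int (X i)\<bar> = 1" "X i \<le> i" by (auto simp: sos_paths_def)
  then show ?case by linarith
qed

lemma Z_free_eq: "Z_free b N = (\<Sum>j=0..N. Z.mp N 0 j / sqrt (b 0 * b j))"
proof -
  have "Z_free b N = (\<Sum>j=0..N. \<Sum>X | X \<in> sos_paths N \<and> X N = j. (1/2) ^ N * (\<Prod>n=0..N. inverse (b (X n))))"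
    unfolding Z_free_def
    by (rule sum.group[symmetric]) (use finite_sos_paths sos_path_le in auto)
  then show ?thesis by (simp only: path_sum)
qed

section \<open>Gibbs potentials as exponential growth rates\<close>

lemma gibbs_bridge: "gibbs_potential_bridge b (- ln \<rho>\<^sub>Q)"
proof -
  have "strict_mono (\<lambda>N::nat. 2 * N)" by (auto simp: strict_mono_def)
  then have "(\<lambda>N. root (2 * N) (1 / b 0)) \<longlonglongrightarrow> 1"
    using LIMSEQ_subseq_LIMSEQ[OF LIMSEQ_root_const[of "1 / b 0"], of "\<lambda>N. 2 * N"] b_pos[of 0]
    by (simp add: o_def)
  from tendsto_mult[OF Z.root_tendsto_rho_star this]
  have "(\<lambda>N. root (2 * N) (Z_bridge b N)) \<longlonglongrightarrow> \<rho>\<^sub>Q"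
    unfolding Z_bridge_eq by (simp add: real_root_mult[symmetric])
  then have "(\<lambda>N. - ln (root (2 * N) (Z_bridge b N))) \<longlonglongrightarrow> - ln \<rho>\<^sub>Q"
    using Z.rho_star_pos by (intro tendsto_intros) auto
  moreover have "eventually (\<lambda>N. - ln (root (2 * N) (Z_bridge b N)) = - (1 / real (2 * N)) * ln (Z_bridge b N)) sequentially"
    using eventually_gt_at_top[of 0]
  proof eventually_elim
    case (elim N)
    then show ?case
      using Z.mp_even_pos[of N] b_pos[of 0] by (subst ln_root) (auto simp: Z_bridge_eq)
  qed
  ultimately show ?thesis unfolding gibbs_potential_bridge_def by (rule Lim_transform_eventually)
qed

text \<open>
  The bound \<open>(Q\<^sup>N)\<^sub>0\<^sub>j\<^sup>2 \<le> (Q\<^sup>2\<^sup>N)\<^sub>0\<^sub>0\<close> limits the gain from freeing the endpoint to a factor linear in \<open>N\<close>.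
\<close>

lemma root_Z_free: "(\<lambda>N. root N (Z_free b N)) \<longlonglongrightarrow> \<rho>\<^sub>Q"
proof (rule root_tendsto_sandwich)
  have weight_nonneg: "0 \<le> Z.mp N 0 j / sqrt (b 0 * b j)" for N j
    using Z.mp_nonneg b_pos[of 0] b_pos[of j] by (intro divide_nonneg_nonneg) (auto simp: less_imp_le)
  show "\<rho>\<^sub>Q > 0" by (rule Z.rho_star_pos)
  {
    fix t assume t: "\<rho>\<^sub>Q < t"
    have "(\<lambda>j. 1 / sqrt (b 0 * b j)) \<longlonglongrightarrow> 1 / sqrt (b 0 * 1)"
      using b_pos[of 0] by (intro tendsto_intros b_lim) auto
    then have "Bseq (\<lambda>j. 1 / sqrt (b 0 * b j))" by (intro convergent_imp_Bseq convergentI)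
    then obtain C where C: "C > 0" "\<And>j. norm (1 / sqrt (b 0 * b j)) \<le> C" by (rule BseqE) blast
    have upper: "Z_free b N \<le> C * (real (Suc N) * \<rho>\<^sub>Q ^ N)" for N
    proof -
      have "Z.mp N 0 j / sqrt (b 0 * b j) \<le> \<rho>\<^sub>Q ^ N * C" for j
      proof -
        have "(Z.mp N 0 j)\<^sup>2 \<le> (\<rho>\<^sub>Q ^ N)\<^sup>2"
          using order.trans[OF Z.mp_square_le[of 0 j N] Z.mp_bot_le] by (simp only: power_even_eq le0)
        then have "Z.mp N 0 j \<le> \<rho>\<^sub>Q ^ N"
          by (rule power2_le_imp_le) (use Z.rho_star_pos in simp)
        then have "Z.mp N 0 j * (1 / sqrt (b 0 * b j)) \<le> \<rho>\<^sub>Q ^ N * C"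
          using C(2)[of j] Z.rho_star_pos b_pos[of 0] b_pos[of j] by (intro mult_mono) auto
        then show ?thesis by simp
      qed
      then have "Z_free b N \<le> (\<Sum>j=0..N. \<rho>\<^sub>Q ^ N * C)" unfolding Z_free_eq by (intro sum_mono)
      then show ?thesis by (simp add: mult_ac)
    qed
    \<comment> \<open>A rate \<open>t\<close> above \<open>\<rho>\<^sub>Q\<close> absorbs the linear
      factor because \<open>(N + 1) * x ^ N\<close> tends to 0.\<close>
    define x where "x = \<rho>\<^sub>Q / t"
    have x: "0 < x" "x < 1" unfolding x_def using t Z.rho_star_pos by auto
    have "(\<lambda>N. real N * x ^ N + x ^ N) \<longlonglongrightarrow> 0 + 0"
      using x by (intro tendsto_add powser_times_n_limit_0 LIMSEQ_power_zero) auto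
    then have "eventually (\<lambda>N. real N * x ^ N + x ^ N < 1) sequentially"
      by (intro order_tendstoD(2)) auto
    then have "eventually (\<lambda>N. Z_free b N \<le> C * t ^ N) sequentially"
    proof eventually_elim
      case (elim N)
      have tpos: "t > 0" using t Z.rho_star_pos by linarith
      have "real (Suc N) * \<rho>\<^sub>Q ^ N = (real N * x ^ N + x ^ N) * t ^ N"
        unfolding x_def using tpos by (simp add: power_divide field_simps)
      also have "\<dots> \<le> 1 * t ^ N" using elim tpos by (intro mult_right_mono) auto
      finally have "C * (real (Suc N) * \<rho>\<^sub>Q ^ N) \<le> C * t ^ N" using C(1) by simp
      then show ?case using upper[of N] by linarith
    qed
    then show "\<exists>K>0. eventually (\<lambda>N. Z_free b N \<le> K * t ^ N) sequentially" using C(1) by blast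
  }
  fix s assume s: "0 < s" "s < \<rho>\<^sub>Q"
  \<comment> \<open>Parity: even lengths are bounded below by paths ending at 0, odd lengths by
    paths with one more step to 1; dividing by \<open>s\<close> accounts for that step.\<close>
  define c where "c = min (1 / b 0) (Q b 0 1 / sqrt (b 0 * b 1) / s)"
  have c: "c > 0" unfolding c_def using s b_pos[of 0] b_pos[of 1] Z.pos[of 0] by simp
  obtain n0 where n0: "\<And>n. n \<ge> n0 \<Longrightarrow> s < root (2 * n) (Z.mp (2 * n) 0 0)"
    using order_tendstoD(1)[OF Z.root_tendsto_rho_star s(2)] by (auto simp: eventually_sequentially)
  have even_bound: "s ^ (2 * n) \<le> Z.mp (2 * n) 0 0" if "n \<ge> max 1 n0" for n
  proof -
    have "s ^ (2 * n) \<le> root (2 * n) (Z.mp (2 * n) 0 0) ^ (2 * n)"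
      using n0[of n] that s by (intro power_mono) auto
    also have "\<dots> = Z.mp (2 * n) 0 0"
      using that Z.mp_even_pos[of n] by (intro real_root_pow_pos2) auto
    finally show ?thesis .
  qed
  have "c * s ^ N \<le> Z_free b N" if N: "N \<ge> 2 * max 1 n0" for N
  proof -
    define n where "n = N div 2"
    have n: "n \<ge> max 1 n0" unfolding n_def using div_le_mono[OF N, of 2] by simp
    have single: "Z.mp N 0 j / sqrt (b 0 * b j) \<le> Z_free b N" if "j \<le> N" for j
      unfolding Z_free_eq using that weight_nonneg by (intro member_le_sum) auto
    show ?thesis
    proof (cases "even N")
      case True
      then have "N = 2 * n" by (simp add: n_def)
      then have "s ^ N / b 0 \<le> Z_free b N"
        using even_bound[OF n] single[of 0] b_pos[of 0] by (auto simp: divide_right_mono intro: order.trans[rotated])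
      moreover have "c * s ^ N \<le> 1 / b 0 * s ^ N" unfolding c_def using s by (intro mult_right_mono) auto
      ultimately show ?thesis by simp
    next
      case False
      then have Nn: "N = Suc (2 * n)" by (simp add: n_def)
      have "Z.mp (2 * n) 0 0 * Q b 0 1 \<le> Z.mp N 0 1"
        using Z.mp_mult_le[of 0 "2 * n" 0 "Suc 0" 1] Z.mp_1[of 1 0] Nn by simp
      moreover have "s ^ (2 * n) * Q b 0 1 \<le> Z.mp (2 * n) 0 0 * Q b 0 1"
        using even_bound[OF n] Z.nonneg by (intro mult_right_mono)
      ultimately have "s ^ (2 * n) * Q b 0 1 / sqrt (b 0 * b 1) \<le> Z.mp N 0 1 / sqrt (b 0 * b 1)"
        using b_pos[of 0] b_pos[of 1] by (intro divide_right_mono) auto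
      also have "\<dots> \<le> Z_free b N" using Nn by (intro single) auto
      finally have le: "s ^ (2 * n) * Q b 0 1 / sqrt (b 0 * b 1) \<le> Z_free b N" .
      have "c * s ^ N \<le> Q b 0 1 / sqrt (b 0 * b 1) / s * s ^ N" unfolding c_def using s by (intro mult_right_mono) auto
      also have "\<dots> = s ^ (2 * n) * Q b 0 1 / sqrt (b 0 * b 1)" unfolding Nn using s by simp
      finally show ?thesis using le by linarith
    qed
  qed
  then show "\<exists>\<kappa>>0. eventually (\<lambda>N. \<kappa> * s ^ N \<le> Z_free b N) sequentially"
    using c by (auto simp: eventually_sequentially)
qed

lemma gibbs_free: "gibbs_potential_free b (- ln \<rho>\<^sub>Q)"
proof -
  have "(\<lambda>N. - ln (root N (Z_free b N))) \<longlonglongrightarrow> - ln \<rho>\<^sub>Q"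
    using root_Z_free Z.rho_star_pos by (intro tendsto_intros) auto
  moreover have "eventually (\<lambda>N. Z_free b N > 0 \<and> N > 0) sequentially"
    using order_tendstoD(1)[OF root_Z_free Z.rho_star_pos] eventually_gt_at_top[of 0]
    by eventually_elim simp
  then have "eventually (\<lambda>N. - ln (root N (Z_free b N)) = - (1 / real N) * ln (Z_free b N)) sequentially"
    by eventually_elim (simp add: ln_root)
  ultimately show ?thesis unfolding gibbs_potential_free_def by (rule Lim_transform_eventually)
qed

end

theorem lemma2:
  fixes b :: "nat \<Rightarrow> real"
  assumes b_pos: "\<And>n. n \<ge> 1 \<Longrightarrow> b n > 0"
    and b_lim: "b \<longlonglongrightarrow> 1"
    and b0_pos: "b 0 > 0"
  shows
    "(ereal (b 0) < b0c b \<longrightarrow>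
        (\<exists>\<rho>::real. \<rho> > 1
           \<and> w1 b \<rho> / ereal (4 * \<rho> * b 1) = ereal (b 0)
           \<and> (\<forall>\<rho>'::real. w1 b \<rho>' / ereal (4 * \<rho>' * b 1) = ereal (b 0) \<longrightarrow> \<rho>' = \<rho>)
           \<and> \<rho> = rho_star UNIV (Q b)
           \<and> gibbs_potential_free b (- ln \<rho>)
           \<and> gibbs_potential_bridge b (- ln \<rho>)))
     \<and> (b0c b < \<infinity> \<and> b0c b < ereal (b 0) \<longrightarrow>
          gibbs_potential_free b 0 \<and> gibbs_potential_bridge b 0)"
proof -
  interpret sos_model b
  proof
    show "b n > 0" for n using b_pos[of n] b0_pos by (cases n) auto
  qed (rule b_lim)
  define \<rho> where "\<rho> = rho_star UNIV (Q b)"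
  have \<rho>: "\<rho>\<^sub>Q = \<rho>" by (simp add: \<rho>_def atLeast_0)
  have ratio: "w1 b t / ereal (4 * t * b 1) = (if R.green_finite t then ereal (F t) else \<infinity>)" if "t > 0" for t
    using w1_ratio[OF that] by (simp only: mult_ac)
  have "\<rho> > 1 \<and> w1 b \<rho> / ereal (4 * \<rho> * b 1) = ereal (b 0)
      \<and> (\<forall>t. w1 b t / ereal (4 * t * b 1) = ereal (b 0) \<longrightarrow> t = \<rho>)"
    if "ereal (b 0) < b0c b"
  proof (intro conjI allI impI)
    note sub = subcritical[OF that, unfolded \<rho>]
    show "\<rho> > 1" by (rule sub)
    then show "w1 b \<rho> / ereal (4 * \<rho> * b 1) = ereal (b 0)" using ratio[of \<rho>] sub by simp
    fix t assume t: "w1 b t / ereal (4 * t * b 1) = ereal (b 0)"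
    \<comment> \<open>Uniqueness ranges over all reals. For \<open>t \<le> 0\<close> the ratio is an
      infinite value of either sign.\<close>
    have t_pos: "t > 0"
    proof (rule ccontr)
      assume "\<not> t > 0"
      then have "w1 b t = \<infinity>" by (intro w1_nonpos) simp
      then show False using t by (simp add: divide_ereal_def ereal_mult_infty split: if_splits)
    qed
    then have "R.green_finite t" "F t = b 0" using ratio[of t] t by (auto split: if_splits)
    \<comment> \<open>A smaller \<open>t\<close> contradicts strict monotonicity of
      \<open>F\<close>, a larger one contradicts \<open>F_less\<close>.\<close>
    then show "t = \<rho>"
      using F_antimono[of t \<rho>] F_less(2)[of t] t_pos sub(3) unfolding \<rho> by (cases t \<rho> rule: linorder_cases) auto
  qed
  moreover have "\<rho> = 1" if "b0c b < ereal (b 0)" using supercritical[OF that] \<rho> by simp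
  ultimately show ?thesis using gibbs_free gibbs_bridge \<rho> unfolding \<rho>_def by auto
qed

end
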